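(* Let $X$ be a connected hyperbolic graph with bounded degree, with vertex set $V$ and edge set $E$, containing at least one bi-infinite geodesic (for the graph metric). Let $\nu$ be a probability measure on $[0,\infty)$ with $\nu(\{0\})=0$ such that, if the lengths $(\omega(e))_{e\in E}$ are chosen independently with law $\nu$, then $\mathbb{E}\, e^{c\,\omega(e)}<\infty$ for some $c>0$. Then for almost every $\omega$, the weighted graph $X_\omega$ admits a bi-infinite geodesic. Moreover, for every fixed bi-infinite quasi-geodesic $\gamma$ in the graph metric of $X$ and every sequence of pairs of vertices $(x_n,y_n)$ of $\gamma$ going to infinity on opposite sides of $\gamma$, for almost every $\omega$ there exists a finite subset $A\subset V$ such that for all $n$ the $\omega$-geodesic between $x_n$ and $y_n$ (any $\omega$-geodesic between them, if it is not unique) crosses $A$, i.e. passes through a vertex of $A$.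
   Context: Graphs are non-oriented and simple (no double edges). $d$ denotes the graph metric on $V$. Paths: a path $\gamma=(e_1,\dots,e_n)$ between vertices $x,y$ is a sequence of consecutive edges joining $x$ to $y$; its vertices are $x=\gamma(0),\dots,\gamma(n)=y$, where $e_{i+1}$ joins $\gamma(i)$ and $\gamma(i+1)$; its length is $|\gamma|=n$, and $\gamma([i,j])$ is the subpath $(e_{i+1},\dots,e_j)$ for $i<j$. Bi-infinite paths (indexed by $\mathbb{Z}$) are defined similarly. A (finite or bi-infinite) path is a geodesic for the graph metric if $d(\gamma(i),\gamma(j))=j-i$ for all indices $i<j$. Hyperbolicity: a geodesic triangle consists of vertices $x_0,x_1,x_2\in V$ and geodesic paths $\gamma_0,\gamma_1,\gamma_2$ such that $\gamma_i$ joins $x_{i+1}$ to $x_{i+2}$, $i\in\mathbb{Z}/3\mathbb{Z}$. It is $\delta$-thin if for every $i$, every vertex on $\gamma_i$ lies at distance at most $\delta$ from $\gamma_{i+1}$ or $\gamma_{i+2}$. The graph is hyperbolic if there is $\delta<\infty$ such that all geodesic triangles are $\delta$-thin. First passage percolation: $\Omega=[0,\infty)^E$ is equipped with the product probability $P$ of copies of $\nu$ (so the edge lengths $\omega(e)$ are i.i.d. with law $\nu$); $\mathbb{E}$ is expectation with respect to $P$, and "almost every $\omega$" refers to $P$. For a finite path $\gamma=(e_1,\dots,e_m)$ let $|\gamma|_\omega=\sum_{i=1}^m\omega(e_i)$, and let $d_\omega(v_1,v_2)$ be the infimum of $|\gamma|_\omega$ over all paths $\gamma$ joining $v_1$ to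 $v_2$. $X_\omega$ denotes the graph $X$ with edge $e$ weighted by $\omega(e)$, with metric $d_\omega$. An $\omega$-geodesic between $x$ and $y$ is a finite path $\gamma$ joining them with $|\gamma|_\omega=d_\omega(x,y)$. A bi-infinite geodesic of $X_\omega$ is a bi-infinite path $\gamma$ such that $|\gamma([i,j])|_\omega=d_\omega(\gamma(i),\gamma(j))$ for all integers $i<j$. Quasi-geodesics (for the graph metric $d$): a bi-infinite path $\gamma$ is a quasi-geodesic if there are $C\ge1$, $K\ge0$ with $j-i\le C\,d(\gamma(i),\gamma(j))+K$ for all integers $i<j$. "$(x_n,y_n)$ going to infinity on opposite sides of $\gamma$" means that $x_n=\gamma(s_n)$, $y_n=\gamma(t_n)$ with $s_n\to-\infty$ and $t_n\to+\infty$ (or vice versa). *)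

theory Defs
  imports "HOL-Probability.Probability"
begin

definition simple_graph :: "'v set \<Rightarrow> 'v set set \<Rightarrow> bool" where
  "simple_graph V E \<longleftrightarrow> (\<forall>e\<in>E. e \<subseteq> V \<and> card e = 2)"

text \<open>In a simple graph a path is determined by the vertices it visits. A finite path
  (e_1, ..., e_n) is therefore represented by the nonempty list [\<gamma>(0), ..., \<gamma>(n)] of its
  vertices, and a bi-infinite path by a function on the integers. Paths may repeat vertices
  and edges, and the list [x] is the path of length 0 from x to x.\<close>

definition path_between :: "'v set \<Rightarrow> 'v set set \<Rightarrow> 'v \<Rightarrow> 'v \<Rightarrow> 'v list \<Rightarrow> bool" where
  "path_between V E x y p \<longleftrightarrow>
     p \<noteq> [] \<and> set p \<subseteq> V \<and> successively (\<lambda>u v. {u, v} \<in> E) p \<and> hd p = x \<and> last p = y"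

definition path_length :: "'v list \<Rightarrow> nat" where
  "path_length p = length p - 1"

definition biinf_path :: "'v set set \<Rightarrow> (int \<Rightarrow> 'v) \<Rightarrow> bool" where
  "biinf_path E \<gamma> \<longleftrightarrow> (\<forall>i. {\<gamma> i, \<gamma> (i + 1)} \<in> E)"

definition connected_graph :: "'v set \<Rightarrow> 'v set set \<Rightarrow> bool" where
  "connected_graph V E \<longleftrightarrow> (\<forall>x\<in>V. \<forall>y\<in>V. \<exists>p. path_between V E x y p)"

definition bounded_degree :: "'v set \<Rightarrow> 'v set set \<Rightarrow> bool" where
  "bounded_degree V E \<longleftrightarrow>
     (\<exists>D::nat. \<forall>v\<in>V. finite {e\<in>E. v \<in> e} \<and> card {e\<in>E. v \<in> e} \<le> D)"

text \<open>The distances below are infima of sets that are nonempty when the graph is connected;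
  without a path from x to y their values are meaningless.\<close>

definition graph_dist :: "'v set \<Rightarrow> 'v set set \<Rightarrow> 'v \<Rightarrow> 'v \<Rightarrow> nat" where
  "graph_dist V E x y = (INF p\<in>{p. path_between V E x y p}. path_length p)"

definition geodesic_between :: "'v set \<Rightarrow> 'v set set \<Rightarrow> 'v \<Rightarrow> 'v \<Rightarrow> 'v list \<Rightarrow> bool" where
  "geodesic_between V E x y p \<longleftrightarrow>
     path_between V E x y p \<and>
     (\<forall>i j. i < j \<and> j \<le> path_length p \<longrightarrow> graph_dist V E (p ! i) (p ! j) = j - i)"

definition biinf_geodesic :: "'v set \<Rightarrow> 'v set set \<Rightarrow> (int \<Rightarrow> 'v) \<Rightarrow> bool" where
  "biinf_geodesic V E \<gamma> \<longleftrightarrow>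
     biinf_path E \<gamma> \<and> (\<forall>i j. i < j \<longrightarrow> int (graph_dist V E (\<gamma> i) (\<gamma> j)) = j - i)"

definition biinf_quasi_geodesic :: "'v set \<Rightarrow> 'v set set \<Rightarrow> (int \<Rightarrow> 'v) \<Rightarrow> bool" where
  "biinf_quasi_geodesic V E \<gamma> \<longleftrightarrow>
     biinf_path E \<gamma> \<and>
     (\<exists>C K :: real. C \<ge> 1 \<and> K \<ge> 0 \<and>
        (\<forall>i j. i < j \<longrightarrow> real_of_int (j - i) \<le> C * real (graph_dist V E (\<gamma> i) (\<gamma> j)) + K))"

text \<open>Corners and sides of a triangle are indexed by \<open>{0, 1, 2}\<close>, read modulo 3.\<close>

definition geodesic_triangle ::
    "'v set \<Rightarrow> 'v set set \<Rightarrow> (nat \<Rightarrow> 'v) \<Rightarrow> (nat \<Rightarrow> 'v list) \<Rightarrow> bool" where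
  "geodesic_triangle V E x \<gamma> \<longleftrightarrow>
     (\<forall>i<3. geodesic_between V E (x ((i + 1) mod 3)) (x ((i + 2) mod 3)) (\<gamma> i))"

definition thin_triangle :: "'v set \<Rightarrow> 'v set set \<Rightarrow> real \<Rightarrow> (nat \<Rightarrow> 'v list) \<Rightarrow> bool" where
  "thin_triangle V E \<delta> \<gamma> \<longleftrightarrow>
     (\<forall>i<3. \<forall>v\<in>set (\<gamma> i). \<exists>w\<in>set (\<gamma> ((i + 1) mod 3)) \<union> set (\<gamma> ((i + 2) mod 3)).
        real (graph_dist V E v w) \<le> \<delta>)"

definition hyperbolic_graph :: "'v set \<Rightarrow> 'v set set \<Rightarrow> bool" where
  "hyperbolic_graph V E \<longleftrightarrow>
     (\<exists>\<delta>::real. \<forall>x \<gamma>. geodesic_triangle V E x \<gamma> \<longrightarrow> thin_triangle V E \<delta> \<gamma>)"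

text \<open>When \<nu> lives on the half-line, the space of this measure consists of the nonnegative
  weight functions on E (extended by \<^const>\<open>undefined\<close> outside E).\<close>

abbreviation fpp_measure :: "'v set set \<Rightarrow> real measure \<Rightarrow> ('v set \<Rightarrow> real) measure" where
  "fpp_measure E \<nu> \<equiv> Pi\<^sub>M E (\<lambda>_. \<nu>)"

definition weighted_length :: "('v set \<Rightarrow> real) \<Rightarrow> 'v list \<Rightarrow> real" where
  "weighted_length \<omega> p = (\<Sum>i<path_length p. \<omega> {p ! i, p ! Suc i})"

definition weighted_dist ::
    "'v set \<Rightarrow> 'v set set \<Rightarrow> ('v set \<Rightarrow> real) \<Rightarrow> 'v \<Rightarrow> 'v \<Rightarrow> real" where
  "weighted_dist V E \<omega> x y = (INF p\<in>{p. path_between V E x y p}. weighted_length \<omega> p)"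

definition weighted_geodesic_between ::
    "'v set \<Rightarrow> 'v set set \<Rightarrow> ('v set \<Rightarrow> real) \<Rightarrow> 'v \<Rightarrow> 'v \<Rightarrow> 'v list \<Rightarrow> bool" where
  "weighted_geodesic_between V E \<omega> x y p \<longleftrightarrow>
     path_between V E x y p \<and> weighted_length \<omega> p = weighted_dist V E \<omega> x y"

definition weighted_biinf_geodesic ::
    "'v set \<Rightarrow> 'v set set \<Rightarrow> ('v set \<Rightarrow> real) \<Rightarrow> (int \<Rightarrow> 'v) \<Rightarrow> bool" where
  "weighted_biinf_geodesic V E \<omega> \<gamma> \<longleftrightarrow>
     biinf_path E \<gamma> \<and>
     (\<forall>i j. i < j \<longrightarrow>
        (\<Sum>k\<in>{i..<j}. \<omega> {\<gamma> k, \<gamma> (k + 1)}) = weighted_dist V E \<omega> (\<gamma> i) (\<gamma> j))"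

definition to_opposite_ends :: "(int \<Rightarrow> 'v) \<Rightarrow> (nat \<Rightarrow> 'v) \<Rightarrow> (nat \<Rightarrow> 'v) \<Rightarrow> bool" where
  "to_opposite_ends \<gamma> x y \<longleftrightarrow>
     (\<exists>s t :: nat \<Rightarrow> int. (\<forall>n. x n = \<gamma> (s n) \<and> y n = \<gamma> (t n)) \<and>
        ((filterlim s at_bot sequentially \<and> filterlim t at_top sequentially) \<or>
         (filterlim s at_top sequentially \<and> filterlim t at_bot sequentially)))"

end

theory Submission
  imports Defs
begin

text \<open>The proof separates geometry from probability. Fix a base vertex o, and let d be the
  graph metric.

  The geometric input is a quantitative form of the exponential divergence of geodesics,
  lemma \<open>path_sees_geodesic\<close>: for a suitable \<open>\<theta> < 1\<close>, every path \<open>v\<close> of \<open>n > 0\<close> edges and every vertex z on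
  a geodesic between its ends, the sum of \<open>\<theta> ^ d (z, v i)\<close> over \<open>i < n\<close> is at least a positive constant.
  Suppose now that v is sparse about z, that is, visits the ball of radius j about z at most
  \<open>\<alpha> * j + \<beta>\<close> times. If v stayed outside the ball of radius R, then the sum would be at most
  the tail from R on of a convergent series, which is too small when R is large. So sparse paths
  pass within a uniform distance of each point of the geodesic (\<open>sparse_path_passes_near\<close>).
  This is used twice.

  First, a quasi-geodesic \<open>\<gamma>\<close> is sparse about every vertex, and it follows that geodesics
  between \<open>\<gamma> a\<close> and \<open>\<gamma> b\<close> for \<open>a \<le> 0 \<le> b\<close> pass within bounded distance of \<open>\<gamma> 0\<close>
  (\<open>quasi_geodesic_passes_near_geodesics\<close>).

  Second, geodesics of almost every weight \<open>\<omega>\<close> are sparse about o. Consider the simple paths p with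
  \<open>d (o, p 0) \<le> n\<close>, where n is the number of edges of p. Their number grows at most exponentially
  in n. The exponential moment, and the absence of an atom at 0, allow a union bound over all
  of them: almost surely their \<open>\<omega>\<close>-length is bounded above and below by linear functions of n
  (\<open>AE_regular\<close>). Two visits of an \<open>\<omega>\<close>-geodesic to the ball of radius j about o can also be
  joined through o by a path of \<open>\<omega>\<close>-length linear in j, so there are only linearly many edges
  between them (\<open>weighted_geodesic_sparse\<close>).

  Hence every \<open>\<omega>\<close>-geodesic between \<open>\<gamma> a\<close> and \<open>\<gamma> b\<close> meets a ball about o whose radius does not depend
  on a and b. As balls are finite, the second claim follows; applied to a bi-infinite geodesic of
  the graph, it lets a compactness argument extract a bi-infinite \<open>\<omega>\<close>-geodesic.\<close>

section \<open>Paths and their lengths\<close>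

text \<open>Cutting a vertex list at a vertex is how paths are decomposed throughout: the cut vertex
  belongs to both pieces, which makes path conditions and lengths additive.\<close>
lemma path_between_append:
  "path_between V E a b (p @ x # q) \<longleftrightarrow>
     path_between V E a x (p @ [x]) \<and> path_between V E x b (x # q)"
  by (auto simp: path_between_def successively_append_iff hd_append)

lemma weighted_length_single [simp]: "weighted_length \<omega> [x] = 0"
  by (simp add: weighted_length_def path_length_def)

lemma weighted_length_Cons:
  "weighted_length \<omega> (x # y # p) = \<omega> {x, y} + weighted_length \<omega> (y # p)"
proof -
  have "weighted_length \<omega> (x # y # p)
      = (\<Sum>i<Suc (length p). \<omega> {(x # y # p) ! i, (x # y # p) ! Suc i})"
    by (simp add: weighted_length_def path_length_def)
  also have "\<dots> = \<omega> {x, y} + (\<Sum>i<length p. \<omega> {(y # p) ! i, (y # p) ! Suc i})"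
    by (subst sum.lessThan_Suc_shift) simp
  finally show ?thesis
    by (simp add: weighted_length_def path_length_def)
qed

lemma weighted_length_append:
  "weighted_length \<omega> (p @ x # q) = weighted_length \<omega> (p @ [x]) + weighted_length \<omega> (x # q)"
proof (induction p)
  case (Cons a p)
  then show ?case
    by (cases p) (auto simp: weighted_length_Cons)
qed simp

lemma path_between_rev: "path_between V E x y p \<Longrightarrow> path_between V E y x (rev p)"
  by (auto simp: path_between_def hd_rev last_rev successively_rev insert_commute)

lemma weighted_length_rev: "weighted_length \<omega> (rev p) = weighted_length \<omega> p"
proof (induction p rule: induct_list012)
  case (3 x y p)
  have "weighted_length \<omega> (rev (x # y # p)) = weighted_length \<omega> (rev p @ y # [x])"
    by simp
  also have "\<dots> = weighted_length \<omega> (rev (y # p)) + \<omega> {y, x}"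
    by (subst weighted_length_append) (simp add: weighted_length_Cons)
  also have "\<dots> = weighted_length \<omega> (x # y # p)"
    using 3 by (simp add: weighted_length_Cons insert_commute)
  finally show ?case .
qed simp_all

text \<open>The number of edges is the length for constant weight 1, so additivity of weighted
  lengths covers the graph metric too.\<close>
lemma path_length_eq_weighted: "real (path_length p) = weighted_length (\<lambda>_. 1) p"
  by (simp add: weighted_length_def)

lemma path_length_rev [simp]: "path_length (rev p) = path_length p"
  by (simp add: path_length_def)

lemma path_between_nth:
  assumes "path_between V E x y p"
  shows "p ! 0 = x" "p ! path_length p = y" "length p = Suc (path_length p)"
    "i \<le> path_length p \<Longrightarrow> p ! i \<in> V"
    "i < path_length p \<Longrightarrow> {p ! i, p ! Suc i} \<in> E"
proof -
  show len: "length p = Suc (path_length p)"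
    using assms by (cases p) (auto simp: path_between_def path_length_def)
  show "p ! 0 = x" "p ! path_length p = y"
    using assms by (auto simp: path_between_def path_length_def hd_conv_nth last_conv_nth)
  show "i \<le> path_length p \<Longrightarrow> p ! i \<in> V"
    using assms len nth_mem[of i p] unfolding path_between_def by auto
  show "i < path_length p \<Longrightarrow> {p ! i, p ! Suc i} \<in> E"
    using assms len unfolding path_between_def successively_conv_nth by simp
qed

lemma path_between_nths:
  assumes "path_between V E x y p" "i \<le> j" "j \<le> path_length p"
  shows "path_between V E (p ! i) (p ! j) (drop i (take (Suc j) p))"
    "path_length (drop i (take (Suc j) p)) = j - i"
proof -
  have len: "length p = Suc (path_length p)"
    using path_between_nth[OF assms(1)] by simp
  then show "path_length (drop i (take (Suc j) p)) = j - i"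
    using assms by (simp add: path_length_def)
  have "set (drop i (take (Suc j) p)) \<subseteq> V"
    using assms(1) by (meson path_between_def order_trans set_drop_subset set_take_subset)
  moreover have "successively (\<lambda>u v. {u, v} \<in> E) (drop i (take (Suc j) p))"
    unfolding successively_conv_nth
  proof (intro allI impI)
    fix k assume "Suc k < length (drop i (take (Suc j) p))"
    then show "{drop i (take (Suc j) p) ! k, drop i (take (Suc j) p) ! Suc k} \<in> E"
      using path_between_nth(5)[OF assms(1), of "i + k"] assms len by simp
  qed
  moreover have "hd (drop i (take (Suc j) p)) = p ! i" "last (drop i (take (Suc j) p)) = p ! j"
    using assms len by (simp_all add: hd_drop_conv_nth last_conv_nth)
  ultimately show "path_between V E (p ! i) (p ! j) (drop i (take (Suc j) p))"
    using assms len by (auto simp: path_between_def)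
qed

lemma path_between_join:
  assumes "path_between V E x y p" "path_between V E y z q"
  obtains r where "path_between V E x z r"
    "\<And>\<omega>. weighted_length \<omega> r = weighted_length \<omega> p + weighted_length \<omega> q"
    "set r = set p \<union> set q"
proof -
  obtain p' where p: "p = p' @ [y]"
    using assms(1) unfolding path_between_def by (metis append_butlast_last_id)
  obtain q' where q: "q = y # q'"
    using assms(2) unfolding path_between_def by (metis list.collapse)
  show thesis
  proof
    show "path_between V E x z (p' @ y # q')"
      using assms p q by (subst path_between_append) simp
    show "weighted_length \<omega> (p' @ y # q') = weighted_length \<omega> p + weighted_length \<omega> q" for \<omega>
      using p q by (subst weighted_length_append) simp
  qed (auto simp: p q)
qed

lemma path_length_join:
  assumes "\<And>\<omega>. weighted_length \<omega> r = weighted_length \<omega> p + weighted_length \<omega> q"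
  shows "path_length r = path_length p + path_length q"
  using assms[of "\<lambda>_. 1"] by (simp flip: path_length_eq_weighted)

lemma weighted_length_nonneg:
  assumes "path_between V E x y p" "\<forall>e\<in>E. 0 \<le> \<omega> e"
  shows "0 \<le> weighted_length \<omega> p"
  unfolding weighted_length_def
  by (intro sum_nonneg assms(2)[rule_format]) (use path_between_nth(5)[OF assms(1)] in auto)

lemma weighted_length_pos:
  assumes "path_between V E x y p" "\<forall>e\<in>E. 0 < \<omega> e" "0 < path_length p"
  shows "0 < weighted_length \<omega> p"
  unfolding weighted_length_def
  by (intro sum_pos assms(2)[rule_format]) (use path_between_nth(5)[OF assms(1)] assms(3) in auto)

section \<open>The graph metric\<close>

locale conn_graph =
  fixes V :: "'v set" and E :: "'v set set"
  assumes simple: "simple_graph V E" and conn: "connected_graph V E"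
begin

abbreviation dist_V :: "'v \<Rightarrow> 'v \<Rightarrow> nat" where "dist_V \<equiv> graph_dist V E"

lemma edge_ends:
  assumes "{u, v} \<in> E"
  shows "u \<in> V" "v \<in> V" "u \<noteq> v"
proof -
  have "{u, v} \<subseteq> V \<and> card {u, v} = 2"
    using simple[unfolded simple_graph_def] assms by (rule bspec)
  then show "u \<in> V" "v \<in> V" "u \<noteq> v" by (auto split: if_splits)
qed

lemma path_exists: "x \<in> V \<Longrightarrow> y \<in> V \<Longrightarrow> \<exists>p. path_between V E x y p"
  using conn unfolding connected_graph_def by blast

lemma path_between_in_V: "path_between V E x y p \<Longrightarrow> x \<in> V \<and> y \<in> V \<and> set p \<subseteq> V"
  by (auto simp: path_between_def)

lemma graph_dist_le: "path_between V E x y p \<Longrightarrow> dist_V x y \<le> path_length p"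
  unfolding graph_dist_def by (intro cINF_lower) auto

lemma shortest_path:
  assumes "x \<in> V" "y \<in> V"
  obtains p where "path_between V E x y p" "path_length p = dist_V x y"
proof -
  have "Inf (path_length ` {p. path_between V E x y p}) \<in> path_length ` {p. path_between V E x y p}"
    using path_exists[OF assms] by (intro Inf_nat_def1) auto
  then show thesis using that unfolding graph_dist_def by auto
qed

lemma graph_dist_self [simp]: "x \<in> V \<Longrightarrow> dist_V x x = 0"
  using graph_dist_le[of x x "[x]"] by (simp add: path_between_def path_length_def)

lemma graph_dist_eq_0:
  assumes "x \<in> V" "y \<in> V" "dist_V x y = 0"
  shows "x = y"
proof -
  obtain p where "path_between V E x y p" "path_length p = dist_V x y"
    using shortest_path assms by blast
  then show ?thesis using assms(3) path_between_nth[of V E x y p] by simp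
qed

lemma graph_dist_le_sym: "x \<in> V \<Longrightarrow> y \<in> V \<Longrightarrow> dist_V x y \<le> dist_V y x"
  by (metis graph_dist_le path_between_rev path_length_rev shortest_path)

lemma graph_dist_sym: "x \<in> V \<Longrightarrow> y \<in> V \<Longrightarrow> dist_V x y = dist_V y x"
  by (simp add: graph_dist_le_sym le_antisym)

lemma graph_dist_triangle:
  assumes "x \<in> V" "y \<in> V" "z \<in> V"
  shows "dist_V x z \<le> dist_V x y + dist_V y z"
proof -
  obtain p where p: "path_between V E x y p" "path_length p = dist_V x y"
    using shortest_path assms by blast
  obtain q where q: "path_between V E y z q" "path_length q = dist_V y z"
    using shortest_path assms by blast
  obtain r where "path_between V E x z r"
    "\<And>\<omega>. weighted_length \<omega> r = weighted_length \<omega> p + weighted_length \<omega> q"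
    using path_between_join[OF p(1) q(1)] by metis
  then show ?thesis using graph_dist_le path_length_join p q by metis
qed

lemma graph_dist_edge: "{u, v} \<in> E \<Longrightarrow> dist_V u v \<le> 1"
  using graph_dist_le[of u v "[u, v]"] edge_ends[of u v]
  by (simp add: path_between_def path_length_def)

lemma graph_dist_steps:
  assumes "\<And>k. i \<le> k \<Longrightarrow> k \<le> j \<Longrightarrow> f k \<in> V"
    and "\<And>k. i \<le> k \<Longrightarrow> k < j \<Longrightarrow> dist_V (f k) (f (Suc k)) \<le> 1" and "i \<le> j"
  shows "dist_V (f i) (f j) \<le> j - i"
  using assms(3) assms(1,2)
proof (induction j rule: dec_induct)
  case (step n)
  have "dist_V (f i) (f (Suc n)) \<le> dist_V (f i) (f n) + dist_V (f n) (f (Suc n))"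
    using step by (intro graph_dist_triangle) auto
  moreover have "dist_V (f i) (f n) \<le> n - i" using step by auto
  moreover have "dist_V (f n) (f (Suc n)) \<le> 1" using step by auto
  ultimately show ?case using step by linarith
qed auto

lemma path_steps:
  assumes "path_between V E x y p" "i \<le> j" "j \<le> path_length p"
  shows "dist_V (p ! i) (p ! j) \<le> j - i"
  using graph_dist_le path_between_nths[OF assms] by metis

lemma shortest_path_dist:
  assumes "path_between V E x y p" "path_length p = dist_V x y" "i \<le> j" "j \<le> path_length p"
  shows "dist_V (p ! i) (p ! j) = j - i"
proof -
  note nth = path_between_nth[OF assms(1)]
  have "dist_V x y \<le> dist_V x (p ! i) + dist_V (p ! i) y"
    "dist_V (p ! i) y \<le> dist_V (p ! i) (p ! j) + dist_V (p ! j) y"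
    using assms path_between_in_V[OF assms(1)] by (auto intro!: graph_dist_triangle nth)
  moreover have "dist_V x (p ! i) \<le> i" "dist_V (p ! j) y \<le> path_length p - j"
    using path_steps[OF assms(1), of 0 i] path_steps[OF assms(1), of j "path_length p"] assms nth
    by auto
  moreover have "dist_V (p ! i) (p ! j) \<le> j - i" using path_steps assms by blast
  ultimately show ?thesis using assms by linarith
qed

lemma shortest_path_distinct:
  assumes "path_between V E x y p" "path_length p = dist_V x y"
  shows "distinct p"
proof -
  have "p ! i \<noteq> p ! j" if "i < j" "j < length p" for i j
  proof
    assume "p ! i = p ! j"
    moreover have "dist_V (p ! i) (p ! j) = j - i"
      using that assms path_between_nth(3)[OF assms(1)] by (intro shortest_path_dist) auto
    moreover have "p ! i \<in> V"
      using that path_between_nth(3,4)[OF assms(1)] by simp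
    ultimately show False using that by simp
  qed
  then show ?thesis unfolding distinct_conv_nth by (metis linorder_neqE_nat)
qed

lemma geodesic_between_shortest:
  assumes "path_between V E x y p" "path_length p = dist_V x y"
  shows "geodesic_between V E x y p"
  using assms shortest_path_dist unfolding geodesic_between_def by auto

lemma biinf_path_in_V: "biinf_path E \<gamma> \<Longrightarrow> \<gamma> i \<in> V"
  unfolding biinf_path_def using edge_ends(1) by blast

lemma quasi_geodesic_reverse:
  assumes "biinf_quasi_geodesic V E \<gamma>"
  shows "biinf_quasi_geodesic V E (\<lambda>i. \<gamma> (- i))"
proof -
  have path: "biinf_path E \<gamma>" using assms by (simp add: biinf_quasi_geodesic_def)
  have \<gamma>V: "\<gamma> i \<in> V" for i using path by (rule biinf_path_in_V)
  obtain C K where CK: "1 \<le> C" "0 \<le> K"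
      "\<And>i j. i < j \<Longrightarrow> real_of_int (j - i) \<le> C * real (dist_V (\<gamma> i) (\<gamma> j)) + K"
    using assms unfolding biinf_quasi_geodesic_def by blast
  have "biinf_path E (\<lambda>i. \<gamma> (- i))"
    unfolding biinf_path_def
  proof
    fix i
    show "{\<gamma> (- i), \<gamma> (- (i + 1))} \<in> E"
      using path[unfolded biinf_path_def, rule_format, of "- i - 1"] by (simp add: insert_commute)
  qed
  moreover have "real_of_int (j - i) \<le> C * real (dist_V (\<gamma> (- i)) (\<gamma> (- j))) + K" if "i < j" for i j
    using CK(3)[of "- j" "- i"] that graph_dist_sym[OF \<gamma>V \<gamma>V, of "- i" "- j"] by simp
  ultimately show ?thesis using CK(1,2) unfolding biinf_quasi_geodesic_def by blast
qed

section \<open>Geodesic intervals\<close>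

text \<open>The union of all geodesics from x to y, in terms of the metric alone.\<close>
definition between :: "'v \<Rightarrow> 'v \<Rightarrow> 'v set" where
  "between x y = {z \<in> V. dist_V x z + dist_V z y = dist_V x y}"

lemma between_sym: "x \<in> V \<Longrightarrow> y \<in> V \<Longrightarrow> between x y = between y x"
  by (auto simp: between_def graph_dist_sym)

lemma shortest_path_between:
  assumes "path_between V E x y p" "path_length p = dist_V x y"
  shows "set p \<subseteq> between x y"
proof
  fix z assume "z \<in> set p"
  then obtain i where i: "i \<le> path_length p" "z = p ! i"
    using path_between_nth(3)[OF assms(1)] by (metis in_set_conv_nth less_Suc_eq_le)
  then show "z \<in> between x y"
    using shortest_path_dist[OF assms, of 0 i] shortest_path_dist[OF assms, of i "path_length p"]
      path_between_nth[OF assms(1)] assms by (auto simp: between_def)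
qed

lemma shortest_path_via:
  assumes "x \<in> V" "y \<in> V" "z \<in> between x y"
  obtains p where "path_between V E x y p" "path_length p = dist_V x y" "z \<in> set p"
proof -
  have z: "z \<in> V" "dist_V x z + dist_V z y = dist_V x y" using assms by (auto simp: between_def)
  obtain p where p: "path_between V E x z p" "path_length p = dist_V x z"
    using shortest_path assms z by blast
  obtain q where q: "path_between V E z y q" "path_length q = dist_V z y"
    using shortest_path assms z by blast
  obtain r where "path_between V E x y r" "set r = set p \<union> set q"
    "\<And>\<omega>. weighted_length \<omega> r = weighted_length \<omega> p + weighted_length \<omega> q"
    using path_between_join[OF p(1) q(1)] by metis
  moreover have "z \<in> set q" using q(1) unfolding path_between_def by (metis hd_in_set)
  ultimately show thesis using that path_length_join[of r p q] p q z by auto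
qed

end

section \<open>Exponential divergence from thin triangles\<close>

locale hyp_graph = conn_graph +
  fixes \<delta> :: nat
  assumes thin: "geodesic_triangle V E x \<gamma> \<Longrightarrow> thin_triangle V E (real \<delta>) \<gamma>"
begin

text \<open>Thinness stated for intervals, so that no particular geodesic has to be carried along: a
  geodesic through z serves as one side of the triangle, and the other two sides are arbitrary.\<close>
lemma thin_between:
  assumes "x \<in> V" "y \<in> V" "w \<in> V" "z \<in> between x y"
  obtains z' where "z' \<in> between x w \<union> between w y" "dist_V z z' \<le> \<delta>"
proof -
  obtain p where p: "path_between V E x y p" "path_length p = dist_V x y" "z \<in> set p"
    using shortest_path_via[OF assms(1,2,4)] by blast
  obtain q where q: "path_between V E y w q" "path_length q = dist_V y w"
    using shortest_path[OF _ _] assms by blast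
  obtain r where r: "path_between V E w x r" "path_length r = dist_V w x"
    using shortest_path[OF _ _] assms by blast
  let ?c = "\<lambda>i::nat. if i = 0 then w else if i = 1 then x else y"
  let ?s = "\<lambda>i::nat. if i = 0 then p else if i = 1 then q else r"
  have "geodesic_triangle V E ?c ?s"
    unfolding geodesic_triangle_def
  proof (intro allI impI)
    fix i :: nat assume "i < 3"
    then consider "i = 0" | "i = 1" | "i = 2" by linarith
    then show "geodesic_between V E (?c ((i + 1) mod 3)) (?c ((i + 2) mod 3)) (?s i)"
      using geodesic_between_shortest[OF p(1,2)] geodesic_between_shortest[OF q]
        geodesic_between_shortest[OF r] by cases (simp_all add: numeral_2_eq_2)
  qed
  then have "thin_triangle V E (real \<delta>) ?s" by (rule thin)
  note thin_triangle_def[THEN iffD1, rule_format, OF this, of 0 z]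
  then have "\<exists>z'\<in>set q \<union> set r. dist_V z z' \<le> \<delta>"
    using p(3) by (simp add: numeral_2_eq_2)
  moreover have "set q \<subseteq> between w y" "set r \<subseteq> between x w"
    using shortest_path_between[OF q] shortest_path_between[OF r] between_sym assms by simp_all
  ultimately show thesis using that by blast
qed

lemma sum_lessThan_add:
  fixes f :: "nat \<Rightarrow> real"
  shows "(\<Sum>i<m + k. f i) = (\<Sum>i<m. f i) + (\<Sum>i<k. f (m + i))"
  by (induction k) auto

text \<open>A path joining the ends of a geodesic must put weight near every point z of it. This is
  the exponential divergence of hyperbolic geometry, in a form close to Frink's metrization
  lemma for the visual quasi-metric seen from z. The proof splits the path at the edge where
  the partial sums pass half of the total S. The quadrilateral spanned by the geodesic, this
  edge and the two remaining pieces is \<open>2 * \<delta>\<close>-thin, so z is within \<open>2 * \<delta>\<close> of the edge, and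
  one term is already large, or of a point z' of a geodesic below one of the two pieces.
  Moving the viewpoint from z to z' costs a factor of at most 2 by the choice of \<open>\<theta>\<close>, and
  this is exactly what restricting to a piece with sum at most \<open>S / 2\<close> gains.\<close>
lemma path_sees_geodesic:
  fixes \<theta> :: real
  assumes \<theta>: "0 < \<theta>" "\<theta> < 1" "1 / 2 \<le> \<theta> ^ (2 * \<delta>)"
    and "0 < n" "\<And>i. i \<le> n \<Longrightarrow> v i \<in> V" "\<And>i. i < n \<Longrightarrow> dist_V (v i) (v (Suc i)) \<le> 1"
    and "z \<in> between (v 0) (v n)"
  shows "\<theta> ^ (2 * \<delta> + 1) \<le> (\<Sum>i<n. \<theta> ^ dist_V z (v i))"
  using assms(4-)
proof (induction n arbitrary: v z rule: less_induct)
  case (less n)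
  note in_V = less.prems(2) and step = less.prems(3)
  have zV: "z \<in> V" using less.prems(4) by (simp add: between_def)
  define a where "a i = \<theta> ^ dist_V z (v i)" for i
  define S where "S = (\<Sum>i<n. a i)"
  have a_pos: "0 < a i" for i using \<theta> by (simp add: a_def)
  have S_ge: "a i \<le> S" if "i < n" for i
    unfolding S_def using that less_imp_le[OF a_pos] by (intro member_le_sum) auto
  have S_pos: "0 < S" using S_ge[OF less.prems(1)] a_pos[of 0] by linarith
  have mono: "\<theta> ^ k \<le> \<theta> ^ j" if "j \<le> k" for j k using \<theta> that by (intro power_decreasing) auto
  \<comment> \<open>The edge from \<open>v m\<close> to \<open>v (Suc m)\<close> is the one at which half of the sum is reached.\<close>
  define m where "m = (LEAST m. S / 2 \<le> (\<Sum>i<Suc m. a i))"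
  have ex: "S / 2 \<le> (\<Sum>i<Suc (n - 1). a i)"
    using less.prems(1) S_pos by (simp add: S_def)
  then have m1: "S / 2 \<le> (\<Sum>i<Suc m. a i)" unfolding m_def by (rule LeastI)
  have "m \<le> n - 1" unfolding m_def using ex by (rule Least_le)
  then have mn: "m < n" using less.prems(1) by simp
  have left: "(\<Sum>i<m. a i) \<le> S / 2"
  proof (cases m)
    case (Suc k)
    then have "\<not> S / 2 \<le> (\<Sum>i<Suc k. a i)" 
      using not_less_Least[of k "\<lambda>m. S / 2 \<le> (\<Sum>i<Suc m. a i)"] unfolding m_def by simp
    then show ?thesis using Suc by simp
  qed (use S_pos in auto)
  have "S = (\<Sum>i<Suc m. a i) + (\<Sum>i<n - Suc m. a (Suc m + i))"
    using mn sum_lessThan_add[of a "Suc m" "n - Suc m"] by (simp add: S_def)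
  then have right: "(\<Sum>i<n - Suc m. a (Suc m + i)) \<le> S / 2" using m1 by linarith
  have near: ?case if "dist_V z (v m) \<le> 2 * \<delta> + 1"
    using mono[OF that] S_ge[OF mn] by (simp add: a_def S_def)
  \<comment> \<open>The case in which z is close to a geodesic below the piece of k edges that starts at \<open>v l\<close>.\<close>
  have far: ?case if "\<theta> ^ (2 * \<delta> + 1) \<le> (\<Sum>i<k. \<theta> ^ dist_V z' (v (l + i)))"
      "(\<Sum>i<k. a (l + i)) \<le> S / 2" "dist_V z z' \<le> 2 * \<delta>" "z' \<in> V" "l + k \<le> n" for z' k l
  proof -
    have "\<theta> ^ (2 * \<delta>) * \<theta> ^ (2 * \<delta> + 1) \<le> (\<Sum>i<k. \<theta> ^ (2 * \<delta>) * \<theta> ^ dist_V z' (v (l + i)))"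
      using that(1) \<theta> by (simp flip: sum_distrib_left)
    also have "\<dots> \<le> (\<Sum>i<k. a (l + i))"
    proof (rule sum_mono)
      fix i assume "i \<in> {..<k}"
      then have "dist_V z (v (l + i)) \<le> dist_V z z' + dist_V z' (v (l + i))"
        using that zV in_V by (intro graph_dist_triangle) auto
      then show "\<theta> ^ (2 * \<delta>) * \<theta> ^ dist_V z' (v (l + i)) \<le> a (l + i)"
        unfolding a_def using that by (subst power_add[symmetric], intro mono) simp
    qed
    also have "\<dots> \<le> S / 2" by (rule that(2))
    also have "\<dots> \<le> \<theta> ^ (2 * \<delta>) * S" using \<theta>(3) S_pos mult_right_mono[OF \<theta>(3), of S] by simp
    finally show ?case using \<theta>(1) by (simp add: S_def a_def)
  qed
  obtain z1 where z1: "z1 \<in> between (v 0) (v m) \<union> between (v m) (v n)" "dist_V z z1 \<le> \<delta>"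
    using thin_between[of "v 0" "v n" "v m" z] less.prems mn by auto
  have z1V: "z1 \<in> V" using z1 by (auto simp: between_def)
  show ?case
  proof (cases "z1 \<in> between (v 0) (v m)")
    case True
    show ?thesis
    proof (cases "m = 0")
      case True
      then have "dist_V (v 0) z1 = 0"
        using \<open>z1 \<in> between (v 0) (v m)\<close> in_V[of 0] by (simp add: between_def)
      then show ?thesis using near z1 True graph_dist_eq_0[OF in_V[of 0] z1V] by auto
    next
      case False
      then have "\<theta> ^ (2 * \<delta> + 1) \<le> (\<Sum>i<m. \<theta> ^ dist_V z1 (v i))"
        using less.IH[OF mn, of v z1] True in_V step mn by auto
      then show ?thesis using far[of z1 0 m] left z1 z1V mn by simp
    qed
  next
    case False
    then obtain z2 where z2: "z2 \<in> between (v m) (v (Suc m)) \<union> between (v (Suc m)) (v n)"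
        "dist_V z1 z2 \<le> \<delta>"
      using thin_between[of "v m" "v n" "v (Suc m)" z1] z1 in_V mn by (auto simp: Suc_le_eq)
    have z2V: "z2 \<in> V" using z2 by (auto simp: between_def)
    have zz2: "dist_V z z2 \<le> 2 * \<delta>"
      using graph_dist_triangle[OF zV z1V z2V] z1 z2 by linarith
    have edge: "dist_V (v m) (v (Suc m)) \<le> 1" using step mn by blast
    have near2: ?thesis if "dist_V (v m) z2 \<le> 1"
      using near graph_dist_triangle[OF zV z2V in_V[of m]] zz2 that mn
        graph_dist_sym[OF z2V in_V[of m]] by simp
    show ?thesis
    proof (cases "z2 \<in> between (v m) (v (Suc m))")
      case True
      then show ?thesis using near2 edge by (auto simp: between_def)
    next
      case False
      then have z2b: "z2 \<in> between (v (Suc m)) (v n)" using z2 by simp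
      show ?thesis
      proof (cases "Suc m = n")
        case True
        then have "dist_V (v n) z2 = 0" using z2b in_V[of n] by (simp add: between_def)
        then show ?thesis using near2 edge True graph_dist_eq_0[OF in_V[of n] z2V] by auto
      next
        case False
        then have "\<theta> ^ (2 * \<delta> + 1) \<le> (\<Sum>i<n - Suc m. \<theta> ^ dist_V z2 (v (Suc m + i)))"
          using less.IH[of "n - Suc m" "\<lambda>i. v (Suc m + i)" z2] z2b in_V step mn by auto
        then show ?thesis by (rule far[OF _ right zz2 z2V]) (use mn in simp)
      qed
    qed
  qed
qed

end

section \<open>Sparse paths follow geodesics\<close>

lemma card_le_of_spread:
  fixes A :: "nat set" and L :: real
  assumes "finite A" "0 \<le> L" "\<And>i i'. i \<in> A \<Longrightarrow> i' \<in> A \<Longrightarrow> i < i' \<Longrightarrow> real (i' - i) \<le> L"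
  shows "real (card A) \<le> L + 1"
proof (cases "A = {}")
  case False
  let ?i = "Min A" and ?j = "Max A"
  have mem: "?i \<in> A" "?j \<in> A" using assms(1) False by auto
  have "card A \<le> card {?i..?j}" using assms(1) by (intro card_mono) auto
  then have "real (card A) \<le> real (?j - ?i) + 1" by simp
  also have "real (?j - ?i) \<le> L"
    using assms(3)[OF mem] assms(2) by (cases "?i < ?j") auto
  finally show ?thesis by simp
qed (use assms in auto)

text \<open>With at most linearly many indices at each height, the sum is dominated by the tail from
  R on of the convergent series of \<open>(\<alpha> * j + \<beta>) * \<theta> ^ j\<close>.\<close>
lemma sparse_heights_small_sum:
  fixes \<theta> \<alpha> \<beta> c :: real
  assumes \<theta>: "0 < \<theta>" "\<theta> < 1" and "0 < c"
  shows "\<exists>R. \<forall>n (h :: nat \<Rightarrow> nat).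
    (\<forall>j. real (card {i. i < n \<and> h i \<le> j}) \<le> \<alpha> * real j + \<beta>) \<and> (\<forall>i<n. R \<le> h i) \<longrightarrow>
    (\<Sum>i<n. \<theta> ^ h i) < c"
proof -
  have "summable (\<lambda>j. real (Suc j) * \<theta> ^ j)"
    using geometric_deriv_sums[of \<theta>] \<theta> by (auto intro: sums_summable)
  then have "summable (\<lambda>j. \<alpha> * (real (Suc j) * \<theta> ^ j) + (\<beta> - \<alpha>) * \<theta> ^ j)"
    using \<theta> by (intro summable_add summable_mult summable_geometric) auto
  then obtain R where R: "\<And>m n. R \<le> m \<Longrightarrow>
      norm (\<Sum>j=m..<n. \<alpha> * (real (Suc j) * \<theta> ^ j) + (\<beta> - \<alpha>) * \<theta> ^ j) < c"
    using \<open>0 < c\<close> unfolding summable_Cauchy by blast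
  have "(\<Sum>i<n. \<theta> ^ h i) < c"
    if count: "\<forall>j. real (card {i. i < n \<and> h i \<le> j}) \<le> \<alpha> * real j + \<beta>"
      and far: "\<forall>i<n. R \<le> h i" for n and h :: "nat \<Rightarrow> nat"
  proof -
    obtain N where N: "\<forall>i<n. h i < N"
      using finite_nat_set_iff_bounded[of "h ` {..<n}"] by auto
    have "(\<Sum>i<n. \<theta> ^ h i) = (\<Sum>j=R..<N. \<Sum>i | i \<in> {..<n} \<and> h i = j. \<theta> ^ h i)"
      using far N by (intro sum.group[symmetric]) auto
    also have "\<dots> = (\<Sum>j=R..<N. real (card {i. i < n \<and> h i = j}) * \<theta> ^ j)"
      by (intro sum.cong refl) simp
    also have "\<dots> \<le> (\<Sum>j=R..<N. (\<alpha> * real j + \<beta>) * \<theta> ^ j)"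
    proof (intro sum_mono mult_right_mono)
      fix j
      have "card {i. i < n \<and> h i = j} \<le> card {i. i < n \<and> h i \<le> j}"
        by (intro card_mono) auto
      then show "real (card {i. i < n \<and> h i = j}) \<le> \<alpha> * real j + \<beta>"
        using count[rule_format, of j] by linarith
    qed (use \<theta> in auto)
    also have "\<dots> = (\<Sum>j=R..<N. \<alpha> * (real (Suc j) * \<theta> ^ j) + (\<beta> - \<alpha>) * \<theta> ^ j)"
      by (intro sum.cong refl) (simp add: algebra_simps)
    also have "\<dots> < c" using R[of R N] by simp
    finally show ?thesis .
  qed
  then show ?thesis by blast
qed

context hyp_graph
begin

text \<open>The exponent \<open>2 * \<delta> + 1\<close> instead of \<open>2 * \<delta>\<close> keeps the root meaningful for \<open>\<delta> = 0\<close>.\<close>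
definition rate :: real where
  "rate = root (2 * \<delta> + 1) (1 / 2)"

lemma rate: "0 < rate" "rate < 1" "1 / 2 \<le> rate ^ (2 * \<delta>)"
proof -
  show pos: "0 < rate" unfolding rate_def by simp
  have eq: "rate ^ (2 * \<delta> + 1) = 1 / 2"
    unfolding rate_def by (intro real_root_pow_pos) auto
  show lt: "rate < 1" unfolding rate_def by simp
  have "rate ^ (2 * \<delta> + 1) \<le> rate ^ (2 * \<delta>)"
    using pos lt by (intro power_decreasing) auto
  then show "1 / 2 \<le> rate ^ (2 * \<delta>)" using eq by simp
qed

text \<open>The Morse property in the form used below. The weight that the path must put near z
  cannot come from far away if the path visits balls about z only linearly often. The bound R
  depends on \<open>\<delta>\<close>, \<open>\<alpha>\<close> and \<open>\<beta>\<close> only, not on the path.\<close>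
lemma sparse_path_passes_near:
  fixes \<alpha> \<beta> :: real
  obtains R :: nat where "\<And>n v z. \<lbrakk>0 < n; \<And>i. i \<le> n \<Longrightarrow> v i \<in> V;
      \<And>i. i < n \<Longrightarrow> dist_V (v i) (v (Suc i)) \<le> 1; z \<in> between (v 0) (v n);
      \<And>j. real (card {i. i < n \<and> dist_V z (v i) \<le> j}) \<le> \<alpha> * real j + \<beta>\<rbrakk>
    \<Longrightarrow> \<exists>i<n. dist_V z (v i) \<le> R"
proof -
  obtain R where R: "\<forall>(n :: nat) h. (\<forall>j. real (card {i. i < n \<and> h i \<le> j}) \<le> \<alpha> * real j + \<beta>) \<and>
      (\<forall>i<n. R \<le> h i) \<longrightarrow> (\<Sum>i<n. rate ^ h i) < rate ^ (2 * \<delta> + 1)"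
    using sparse_heights_small_sum[OF rate(1,2), where c = "rate ^ (2 * \<delta> + 1)"
        and \<alpha> = \<alpha> and \<beta> = \<beta>, OF zero_less_power[OF rate(1)]] by (rule exE)
  show thesis
  proof (rule that[of R])
    fix n v z
    assume *: "0 < n" "\<And>i. i \<le> n \<Longrightarrow> v i \<in> V"
      "\<And>i. i < n \<Longrightarrow> dist_V (v i) (v (Suc i)) \<le> 1" "z \<in> between (v 0) (v n)"
      "\<And>j. real (card {i. i < n \<and> dist_V z (v i) \<le> j}) \<le> \<alpha> * real j + \<beta>"
    have "rate ^ (2 * \<delta> + 1) \<le> (\<Sum>i<n. rate ^ dist_V z (v i))"
      by (rule path_sees_geodesic[OF rate *(1-4)])
    then have "\<not> (\<forall>i<n. R \<le> dist_V z (v i))"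
      using R[THEN spec, THEN spec, of n "\<lambda>i. dist_V z (v i)"] *(5) by (auto simp: not_less)
    then show "\<exists>i<n. dist_V z (v i) \<le> R" by (auto simp: not_le intro: less_imp_le)
  qed
qed

text \<open>A quasi-geodesic is sparse about every vertex z, since the indices of two visits to a
  ball of radius j differ by at most \<open>2 * C * j + K\<close>. Hence each point of a geodesic chord is
  close to the part of \<open>\<gamma>\<close> below it. Walking along the chord from \<open>\<gamma> a\<close> to \<open>\<gamma> b\<close>, the nearby
  points of \<open>\<gamma>\<close> change from nonpositive to nonnegative indices; at the change two of them are
  close to each other, so both indices are bounded and the chord is near \<open>\<gamma> 0\<close>.\<close>
lemma quasi_geodesic_passes_near_geodesics:
  assumes "biinf_quasi_geodesic V E \<gamma>"
  obtains M where "\<And>a b. a \<le> 0 \<Longrightarrow> 0 \<le> b \<Longrightarrow>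
    \<exists>z\<in>between (\<gamma> a) (\<gamma> b). dist_V (\<gamma> 0) z \<le> M"
proof -
  have path: "biinf_path E \<gamma>" using assms by (simp add: biinf_quasi_geodesic_def)
  then have \<gamma>V: "\<gamma> i \<in> V" for i by (rule biinf_path_in_V)
  obtain C K where CK: "1 \<le> C" "0 \<le> K"
      "\<And>i j. i < j \<Longrightarrow> real_of_int (j - i) \<le> C * real (dist_V (\<gamma> i) (\<gamma> j)) + K"
    using assms unfolding biinf_quasi_geodesic_def by blast
  have edge: "dist_V (\<gamma> (i + int k)) (\<gamma> (i + int (Suc k))) \<le> 1" for i k
    using graph_dist_edge path unfolding biinf_path_def
    by (metis add.assoc of_nat_Suc add.commute)
  obtain R where R: "\<And>n v z. \<lbrakk>0 < n; \<And>i. i \<le> n \<Longrightarrow> v i \<in> V;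
      \<And>i. i < n \<Longrightarrow> dist_V (v i) (v (Suc i)) \<le> 1; z \<in> between (v 0) (v n);
      \<And>j. real (card {i. i < n \<and> dist_V z (v i) \<le> j}) \<le> 2 * C * real j + (K + 1)\<rbrakk>
    \<Longrightarrow> \<exists>i<n. dist_V z (v i) \<le> R"
    using sparse_path_passes_near by blast
  have near: "\<exists>i\<ge>a. i \<le> b \<and> dist_V z (\<gamma> i) \<le> R"
    if "a \<le> b" and z: "z \<in> between (\<gamma> a) (\<gamma> b)" for a b z
  proof (cases "a = b")
    case True
    have "dist_V (\<gamma> a) z = 0" "z \<in> V" using z True \<gamma>V by (auto simp: between_def)
    then have "dist_V z (\<gamma> a) \<le> R" using graph_dist_sym[OF \<gamma>V] by simp
    then show ?thesis using True by blast
  next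
    case False
    have zV: "z \<in> V" using z by (simp add: between_def)
    have "real (card {i. i < nat (b - a) \<and> dist_V z (\<gamma> (a + int i)) \<le> j}) \<le> (2 * C * real j + K) + 1" for j
    proof (intro card_le_of_spread)
      fix i i' assume i: "i \<in> {i. i < nat (b - a) \<and> dist_V z (\<gamma> (a + int i)) \<le> j}"
        "i' \<in> {i. i < nat (b - a) \<and> dist_V z (\<gamma> (a + int i)) \<le> j}" "i < i'"
      have "dist_V (\<gamma> (a + int i)) (\<gamma> (a + int i')) \<le> 2 * j"
        using i graph_dist_triangle[OF \<gamma>V zV \<gamma>V, of "a + int i" "a + int i'"]
          graph_dist_sym[OF \<gamma>V zV, of "a + int i"] by simp
      then have "C * real (dist_V (\<gamma> (a + int i)) (\<gamma> (a + int i'))) \<le> C * real (2 * j)"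
        using CK(1) by (intro mult_left_mono) auto
      then show "real (i' - i) \<le> 2 * C * real j + K"
        using CK(3)[of "a + int i" "a + int i'"] i(3) by simp
    qed (use CK in auto)
    then have "\<exists>i<nat (b - a). dist_V z (\<gamma> (a + int i)) \<le> R"
      using that False \<gamma>V edge by (intro R) (auto simp: add.assoc)
    then obtain i where "i < nat (b - a)" "dist_V z (\<gamma> (a + int i)) \<le> R" by blast
    then show ?thesis by (intro exI[of _ "a + int i"]) auto
  qed
  define M where "M = R + nat \<lceil>C * real (2 * R + 1) + K\<rceil>"
  show thesis
  proof (rule that[of M])
    fix a b :: int assume ab: "a \<le> 0" "0 \<le> b"
    obtain p where p: "path_between V E (\<gamma> a) (\<gamma> b) p" "path_length p = dist_V (\<gamma> a) (\<gamma> b)"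
      using shortest_path \<gamma>V by blast
    note nth = path_between_nth[OF p(1)]
    have btw: "p ! i \<in> between (\<gamma> a) (\<gamma> b)" if "i \<le> path_length p" for i
      using shortest_path_between[OF p] nth(3) that by auto
    define P where "P i \<longleftrightarrow> i \<le> path_length p \<and> (\<exists>k\<le>0. dist_V (p ! i) (\<gamma> k) \<le> R)" for i
    have "P 0" using nth(1) \<gamma>V ab(1) unfolding P_def by (intro conjI exI[of _ a]) auto
    \<comment> \<open>The last point of the chord that is close to \<open>\<gamma>\<close> at a nonpositive index.\<close>
    then obtain i where i: "P i" "\<And>j. P j \<Longrightarrow> j \<le> i"
      using GreatestI_nat[of P 0 "path_length p"] Greatest_le_nat[of P _ "path_length p"]
      unfolding P_def by blast
    then obtain k where k: "k \<le> 0" "dist_V (p ! i) (\<gamma> k) \<le> R" "i \<le> path_length p"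
      unfolding P_def by blast
    have zV: "p ! i \<in> V" using nth(4) k(3) by blast
    obtain k' where k': "0 \<le> k'" "dist_V (p ! i) (\<gamma> k') \<le> R + 1"
    proof (cases "i = path_length p")
      case True
      then show ?thesis using that[of b] ab nth(2) \<gamma>V by simp
    next
      case False
      then have le: "Suc i \<le> path_length p" using k(3) by simp
      obtain k' where k': "dist_V (p ! Suc i) (\<gamma> k') \<le> R"
        using near[OF _ btw[OF le]] ab by auto
      have "\<not> k' \<le> 0" using i(2)[of "Suc i"] k' le unfolding P_def by auto
      moreover have "dist_V (p ! i) (p ! Suc i) \<le> 1"
        using graph_dist_edge nth(5) le by auto
      ultimately show ?thesis
        using that[of k'] k' graph_dist_triangle[OF zV nth(4)[OF le] \<gamma>V, of k'] by simp
    qed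
    have kk': "real_of_int (k' - k) \<le> C * real (2 * R + 1) + K"
    proof (cases "k < k'")
      case True
      have "dist_V (\<gamma> k) (\<gamma> k') \<le> 2 * R + 1"
        using graph_dist_triangle[OF \<gamma>V zV \<gamma>V, of k k'] graph_dist_sym[OF \<gamma>V zV, of k] k k' by simp
      then have "C * real (dist_V (\<gamma> k) (\<gamma> k')) \<le> C * real (2 * R + 1)"
        using CK(1) by (intro mult_left_mono) auto
      then show ?thesis using CK(3)[OF True] by linarith
    next
      case False
      then have "k' - k \<le> 0" by simp
      then have "real_of_int (k' - k) \<le> 0" by linarith
      also have "0 \<le> C * real (2 * R + 1) + K" using CK by simp
      finally show ?thesis .
    qed
    have "dist_V (\<gamma> k) (\<gamma> 0) \<le> nat (- k)"
    proof -
      have "dist_V (\<gamma> (k + int 0)) (\<gamma> (k + int (nat (- k)))) \<le> nat (- k) - 0"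
        using edge \<gamma>V by (intro graph_dist_steps[where f = "\<lambda>i. \<gamma> (k + int i)"]) auto
      then show ?thesis using k(1) by simp
    qed
    moreover have "nat (- k) \<le> nat \<lceil>C * real (2 * R + 1) + K\<rceil>"
    proof -
      have "real_of_int (- k) \<le> C * real (2 * R + 1) + K" using kk' k'(1) by simp
      then show ?thesis by linarith
    qed
    ultimately have "dist_V (\<gamma> 0) (p ! i) \<le> M"
      using graph_dist_triangle[OF zV \<gamma>V[of k] \<gamma>V[of 0]] graph_dist_sym[OF zV \<gamma>V, of 0] k(2)
      unfolding M_def by linarith
    then show "\<exists>z\<in>between (\<gamma> a) (\<gamma> b). dist_V (\<gamma> 0) z \<le> M" using btw[OF k(3)] by blast
  qed
qed

end

section \<open>Geodesics of positive edge weights\<close>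

context conn_graph
begin

lemma weighted_dist_le:
  assumes "\<forall>e\<in>E. 0 \<le> \<omega> e" "path_between V E x y p"
  shows "weighted_dist V E \<omega> x y \<le> weighted_length \<omega> p"
  unfolding weighted_dist_def
proof (rule cINF_lower)
  show "bdd_below (weighted_length \<omega> ` {p. path_between V E x y p})"
    using weighted_length_nonneg[OF _ assms(1)] by (intro bdd_belowI[of _ 0]) auto
qed (use assms in simp)

text \<open>Weighted geodesics as shortest paths, which avoids the infimum in the distance.\<close>
lemma weighted_geodesic_iff:
  assumes "\<forall>e\<in>E. 0 \<le> \<omega> e"
  shows "weighted_geodesic_between V E \<omega> x y p \<longleftrightarrow> path_between V E x y p \<and>
    (\<forall>q. path_between V E x y q \<longrightarrow> weighted_length \<omega> p \<le> weighted_length \<omega> q)"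
proof (intro iffI conjI allI impI)
  assume p: "path_between V E x y p \<and>
    (\<forall>q. path_between V E x y q \<longrightarrow> weighted_length \<omega> p \<le> weighted_length \<omega> q)"
  then have "weighted_length \<omega> p \<le> weighted_dist V E \<omega> x y"
    unfolding weighted_dist_def by (intro cINF_greatest) auto
  then show "weighted_geodesic_between V E \<omega> x y p"
    using weighted_dist_le[OF assms] p unfolding weighted_geodesic_between_def
    by (auto intro: antisym)
qed (use weighted_dist_le[OF assms] in \<open>auto simp: weighted_geodesic_between_def\<close>)

text \<open>Replacing one piece of a weighted geodesic by a competitor cannot shorten the whole.\<close>
lemma weighted_geodesic_append:
  assumes \<omega>: "\<forall>e\<in>E. 0 \<le> \<omega> e"
    and g: "weighted_geodesic_between V E \<omega> a b (p @ x # q)"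
  shows "weighted_geodesic_between V E \<omega> a x (p @ [x])"
    "weighted_geodesic_between V E \<omega> x b (x # q)"
proof -
  have path: "path_between V E a x (p @ [x])" "path_between V E x b (x # q)"
    using g path_between_append unfolding weighted_geodesic_between_def by metis+
  have opt: "weighted_length \<omega> (p @ [x]) + weighted_length \<omega> (x # q) \<le> weighted_length \<omega> r"
    if "path_between V E a b r" for r
    using g that weighted_length_append[of \<omega> p x q] unfolding weighted_geodesic_iff[OF \<omega>] by simp
  show "weighted_geodesic_between V E \<omega> a x (p @ [x])"
    unfolding weighted_geodesic_iff[OF \<omega>]
  proof (intro conjI allI impI path)
    fix r assume "path_between V E a x r"
    then obtain s where "path_between V E a b s"
      "\<And>\<omega>. weighted_length \<omega> s = weighted_length \<omega> r + weighted_length \<omega> (x # q)"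
      using path_between_join path(2) by metis
    then show "weighted_length \<omega> (p @ [x]) \<le> weighted_length \<omega> r" using opt[of s] by simp
  qed
  show "weighted_geodesic_between V E \<omega> x b (x # q)"
    unfolding weighted_geodesic_iff[OF \<omega>]
  proof (intro conjI allI impI path)
    fix r assume "path_between V E x b r"
    then obtain s where "path_between V E a b s"
      "\<And>\<omega>. weighted_length \<omega> s = weighted_length \<omega> (p @ [x]) + weighted_length \<omega> r"
      using path_between_join path(1) by metis
    then show "weighted_length \<omega> (x # q) \<le> weighted_length \<omega> r" using opt[of s] by simp
  qed
qed

lemma weighted_geodesic_nths:
  assumes \<omega>: "\<forall>e\<in>E. 0 \<le> \<omega> e"
    and g: "weighted_geodesic_between V E \<omega> x y p" and ij: "i \<le> j" "j \<le> path_length p"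
  shows "weighted_geodesic_between V E \<omega> (p ! i) (p ! j) (drop i (take (Suc j) p))"
proof -
  have len: "length p = Suc (path_length p)"
    using g path_between_nth(3) unfolding weighted_geodesic_between_def by metis
  have "weighted_geodesic_between V E \<omega> x y (take j p @ p ! j # drop (Suc j) p)"
    using g len ij by (subst id_take_nth_drop[symmetric]) auto
  note weighted_geodesic_append(1)[OF \<omega> this]
  then have 1: "weighted_geodesic_between V E \<omega> x (p ! j) (take (Suc j) p)"
    using len ij by (simp add: take_Suc_conv_app_nth)
  let ?q = "take (Suc j) p"
  have i: "i < length ?q" using len ij by simp
  have "weighted_geodesic_between V E \<omega> x (p ! j) (take i ?q @ ?q ! i # drop (Suc i) ?q)"
    using 1 by (subst id_take_nth_drop[OF i, symmetric])
  note weighted_geodesic_append(2)[OF \<omega> this]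
  then show ?thesis using Cons_nth_drop_Suc[OF i] ij by simp
qed

lemma weighted_length_nths:
  assumes "j < length p" "i \<le> j"
  shows "weighted_length \<omega> (drop i (take (Suc j) p)) = (\<Sum>k=i..<j. \<omega> {p ! k, p ! Suc k})"
proof -
  have "weighted_length \<omega> (drop i (take (Suc j) p))
      = (\<Sum>k<j - i. \<omega> {p ! (i + k), p ! Suc (i + k)})"
    unfolding weighted_length_def path_length_def using assms by (intro sum.cong) auto
  also have "\<dots> = (\<Sum>k=i..<j. \<omega> {p ! k, p ! Suc k})"
    using assms
    by (intro sum.reindex_bij_witness[of _ "\<lambda>k. k - i" "\<lambda>k. i + k"]) auto
  finally show ?thesis .
qed

text \<open>A return to the same vertex would be a loop of positive length between two points at
  distance 0.\<close>
lemma weighted_geodesic_distinct: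
  assumes \<omega>: "\<forall>e\<in>E. 0 < \<omega> e"
    and g: "weighted_geodesic_between V E \<omega> x y p"
  shows "distinct p"
proof -
  have p: "path_between V E x y p" using g by (simp add: weighted_geodesic_between_def)
  note nth = path_between_nth[OF p]
  have \<omega>': "\<forall>e\<in>E. 0 \<le> \<omega> e" using \<omega> by (auto intro: less_imp_le)
  have "p ! i \<noteq> p ! j" if "i < j" "j < length p" for i j
  proof
    assume eq: "p ! i = p ! j"
    let ?q = "drop i (take (Suc j) p)"
    have ij: "i \<le> j" "j \<le> path_length p" using that nth(3) by auto
    note sub = path_between_nths[OF p ij]
    have "weighted_geodesic_between V E \<omega> (p ! i) (p ! j) ?q"
      by (rule weighted_geodesic_nths[OF \<omega>' g ij])
    moreover have "path_between V E (p ! i) (p ! j) [p ! i]"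
      using eq nth(4) ij by (simp add: path_between_def)
    ultimately have "weighted_length \<omega> ?q \<le> weighted_length \<omega> [p ! i]"
      unfolding weighted_geodesic_iff[OF \<omega>'] by blast
    moreover have "0 < weighted_length \<omega> ?q"
      using weighted_length_pos[OF sub(1) \<omega>] sub(2) that by simp
    ultimately show False by simp
  qed
  then show ?thesis unfolding distinct_conv_nth by (metis linorder_neqE_nat)
qed

lemma loop_erasure:
  assumes \<omega>: "\<forall>e\<in>E. 0 \<le> \<omega> e" and p: "path_between V E x y p"
  shows "\<exists>q. path_between V E x y q \<and> distinct q \<and> weighted_length \<omega> q \<le> weighted_length \<omega> p"
  using p
proof (induction p rule: length_induct)
  case (1 p)
  show ?case
  proof (cases "distinct p")
    case False
    then obtain a v b c where p: "p = a @ v # (b @ v # c)"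
      using not_distinct_decomp by force
    have ab: "path_between V E x v (a @ [v])" "path_between V E v v (v # b @ [v])"
      "path_between V E v y (v # c)"
      using 1(2) path_between_append[of V E x y a v "b @ v # c"]
        path_between_append[of V E v y "v # b" v c] unfolding p by simp_all
    have "path_between V E x y (a @ v # c)"
      using ab path_between_append by metis
    moreover have "length (a @ v # c) < length p" by (simp add: p)
    ultimately obtain q where q: "path_between V E x y q" "distinct q"
        "weighted_length \<omega> q \<le> weighted_length \<omega> (a @ v # c)"
      using 1(1) by blast
    have "weighted_length \<omega> p = weighted_length \<omega> (a @ [v]) + (weighted_length \<omega> (v # b @ [v])
        + weighted_length \<omega> (v # c))"
      using weighted_length_append[of \<omega> a v "b @ v # c"] weighted_length_append[of \<omega> "v # b" v c]
      by (simp add: p)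
    moreover have "weighted_length \<omega> (a @ v # c) = weighted_length \<omega> (a @ [v]) + weighted_length \<omega> (v # c)"
      by (rule weighted_length_append)
    moreover have "0 \<le> weighted_length \<omega> (v # b @ [v])"
      using weighted_length_nonneg[OF ab(2) \<omega>] by simp
    ultimately show ?thesis using q by (intro exI[of _ q]) auto
  qed (use 1(2) in auto)
qed

end

section \<open>Counting vertices and paths\<close>

locale fpp_graph = hyp_graph +
  fixes D :: nat and base :: 'a
  assumes degree: "v \<in> V \<Longrightarrow> finite {e \<in> E. v \<in> e} \<and> card {e \<in> E. v \<in> e} \<le> D"
    and base: "base \<in> V"
begin

definition nbrs :: "'a \<Rightarrow> 'a set" where
  "nbrs v = {u. {v, u} \<in> E}"

lemma nbrs: "finite (nbrs v)" "card (nbrs v) \<le> D" if "v \<in> V"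
proof -
  have inj: "inj_on (\<lambda>u. {v, u}) (nbrs v)" by (auto simp: inj_on_def doubleton_eq_iff)
  have sub: "(\<lambda>u. {v, u}) ` nbrs v \<subseteq> {e \<in> E. v \<in> e}" by (auto simp: nbrs_def)
  show "finite (nbrs v)" using inj_on_finite[OF inj sub] degree[OF that] by blast
  show "card (nbrs v) \<le> D" using card_inj_on_le[OF inj sub] degree[OF that] by linarith
qed

definition centred_ball :: "nat \<Rightarrow> 'a set" where
  "centred_ball n = {v \<in> V. dist_V base v \<le> n}"

text \<open>The vertex before the last on a geodesic from the base is one step closer to it.\<close>
lemma centred_ball_Suc: "centred_ball (Suc n) \<subseteq> centred_ball n \<union> (\<Union>u\<in>centred_ball n. nbrs u)"
proof
  fix v assume v: "v \<in> centred_ball (Suc n)"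
  show "v \<in> centred_ball n \<union> (\<Union>u\<in>centred_ball n. nbrs u)"
  proof (cases "dist_V base v \<le> n")
    case False
    then have d: "dist_V base v = Suc n" and vV: "v \<in> V" using v by (auto simp: centred_ball_def)
    obtain p where p: "path_between V E base v p" "path_length p = dist_V base v"
      using shortest_path[OF base vV] by blast
    note nth = path_between_nth[OF p(1)]
    have "dist_V (p ! 0) (p ! n) = n - 0" using shortest_path_dist[OF p, of 0 n] p(2) d by simp
    then have "p ! n \<in> centred_ball n" using nth(1) nth(4)[of n] p(2) d by (simp add: centred_ball_def)
    moreover have "v \<in> nbrs (p ! n)" using nth(5)[of n] nth(2) p(2) d by (simp add: nbrs_def)
    ultimately show ?thesis by blast
  qed (use v in \<open>auto simp: centred_ball_def\<close>)
qed

lemma centred_ball: "finite (centred_ball n) \<and> card (centred_ball n) \<le> (D + 1) ^ n"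
proof (induction n)
  case 0
  have "centred_ball 0 \<subseteq> {base}" using graph_dist_eq_0 base by (auto simp: centred_ball_def)
  then show ?case using finite_subset[of _ "{base}"] card_mono[of "{base}"] by auto
next
  case (Suc n)
  let ?B = "centred_ball n"
  have V: "u \<in> V" if "u \<in> ?B" for u using that by (simp add: centred_ball_def)
  have fin: "finite (?B \<union> (\<Union>u\<in>?B. nbrs u))" using Suc nbrs(1) V by auto
  have "card (centred_ball (Suc n)) \<le> card (?B \<union> (\<Union>u\<in>?B. nbrs u))"
    using fin centred_ball_Suc by (rule card_mono)
  also have "\<dots> \<le> card ?B + card (\<Union>u\<in>?B. nbrs u)" by (rule card_Un_le)
  also have "card (\<Union>u\<in>?B. nbrs u) \<le> (\<Sum>u\<in>?B. card (nbrs u))" using Suc by (intro card_UN_le) auto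
  also have "\<dots> \<le> (\<Sum>u\<in>?B. D)" using nbrs(2) V by (intro sum_mono) auto
  also have "card ?B + (\<Sum>u\<in>?B. D) = (D + 1) * card ?B" by simp
  also have "\<dots> \<le> (D + 1) ^ Suc n" using Suc unfolding power_Suc by (intro mult_le_mono) auto
  finally show ?case using finite_subset[OF centred_ball_Suc fin] by simp
qed

definition walks :: "'a \<Rightarrow> nat \<Rightarrow> 'a list set" where
  "walks v n = {p. path_between V E v (last p) p \<and> path_length p = n}"

lemma walks: "v \<in> V \<Longrightarrow> finite (walks v n) \<and> card (walks v n) \<le> D ^ n"
proof (induction n arbitrary: v)
  case 0
  have "walks v 0 \<subseteq> {[v]}"
  proof
    fix p assume "p \<in> walks v 0"
    then show "p \<in> {[v]}"
      by (cases p) (auto simp: walks_def path_between_def path_length_def)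
  qed
  then show ?case using finite_subset[of _ "{[v]}"] card_mono[of "{[v]}"] by auto
next
  case (Suc n)
  have V: "u \<in> V" if "u \<in> nbrs v" for u using that edge_ends(2) by (auto simp: nbrs_def)
  let ?U = "\<Union>u\<in>nbrs v. walks u n"
  have sub: "walks v (Suc n) \<subseteq> (#) v ` ?U"
  proof
    fix p assume p: "p \<in> walks v (Suc n)"
    then obtain u q where q: "p = v # u # q"
      by (cases p; cases "tl p") (auto simp: walks_def path_between_def path_length_def)
    then have "u \<in> nbrs v" "u # q \<in> walks u n"
      using p by (auto simp: walks_def path_between_def path_length_def nbrs_def)
    then show "p \<in> (#) v ` ?U" using q by blast
  qed
  have fin: "finite ?U" using Suc nbrs(1) V by auto
  have "card (walks v (Suc n)) \<le> card ((#) v ` ?U)" using fin sub by (intro card_mono) auto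
  also have "\<dots> \<le> card ?U" using fin by (rule card_image_le)
  also have "\<dots> \<le> (\<Sum>u\<in>nbrs v. card (walks u n))" using Suc.prems nbrs by (intro card_UN_le) auto
  also have "\<dots> \<le> (\<Sum>u\<in>nbrs v. D ^ n)" using Suc.IH V by (intro sum_mono) auto
  also have "\<dots> \<le> D * D ^ n" using nbrs(2)[OF Suc.prems] by (simp add: mult_le_mono)
  finally show ?case using finite_subset[OF sub] fin by simp
qed

text \<open>Simple paths that are at least as long as the distance of their start from the base.
  There are only exponentially many of each length, which is what a union bound can afford,
  and yet they see everything that a weighted geodesic does on the scale of its distance
  from the base.\<close>
definition long_paths :: "nat \<Rightarrow> 'a list set" where
  "long_paths n = {p. path_between V E (hd p) (last p) p \<and> distinct p \<and> path_length p = n \<and>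
     dist_V base (hd p) \<le> n}"

lemma long_paths: "finite (long_paths n)" "card (long_paths n) \<le> ((D + 1) * D) ^ n"
proof -
  let ?U = "\<Union>v\<in>centred_ball n. walks v n"
  have V: "u \<in> V" if "u \<in> centred_ball n" for u using that by (simp add: centred_ball_def)
  have sub: "long_paths n \<subseteq> ?U"
    by (auto simp: long_paths_def walks_def centred_ball_def dest: path_between_in_V)
  have fin: "finite ?U" using centred_ball walks V by auto
  show "finite (long_paths n)" using sub fin by (rule finite_subset)
  have "card (long_paths n) \<le> card ?U" using fin sub by (rule card_mono)
  also have "\<dots> \<le> (\<Sum>v\<in>centred_ball n. card (walks v n))" using centred_ball by (intro card_UN_le) auto
  also have "\<dots> \<le> (\<Sum>v\<in>centred_ball n. D ^ n)" using walks V by (intro sum_mono) auto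
  also have "\<dots> \<le> (D + 1) ^ n * D ^ n" using centred_ball[of n] by (simp add: mult_le_mono)
  finally show "card (long_paths n) \<le> ((D + 1) * D) ^ n" unfolding power_mult_distrib .
qed

lemma countable_V: "countable V"
proof -
  have "V \<subseteq> (\<Union>n. centred_ball n)" by (auto simp: centred_ball_def)
  moreover have "countable (\<Union>n. centred_ball n)"
    using centred_ball by (intro countable_UN) (auto intro: countable_finite)
  ultimately show ?thesis by (rule countable_subset)
qed

lemma countable_E: "countable E"
proof -
  have "E \<subseteq> (\<lambda>(u, v). {u, v}) ` (V \<times> V)"
  proof
    fix e assume e: "e \<in> E"
    then have "e \<subseteq> V \<and> card e = 2" using simple[unfolded simple_graph_def] by blast
    then obtain u v where "e = {u, v}" "u \<in> V" "v \<in> V" unfolding card_2_iff by auto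
    then show "e \<in> (\<lambda>(u, v). {u, v}) ` (V \<times> V)" by auto
  qed
  moreover have "countable ((\<lambda>(u, v). {u, v}) ` (V \<times> V))" using countable_V by auto
  ultimately show ?thesis by (rule countable_subset)
qed

section \<open>Geodesics of regular weights\<close>

text \<open>On the paths above, weighted length and number of edges are comparable up to an additive
  constant. Almost every weight has this property, and it is all that is used of the weight.\<close>
definition regular :: "('a set \<Rightarrow> real) \<Rightarrow> bool" where
  "regular \<omega> \<longleftrightarrow> (\<forall>e\<in>E. 0 < \<omega> e) \<and> (\<exists>C t M. 0 \<le> C \<and> 0 \<le> t \<and> 0 \<le> M \<and>
     (\<forall>n. \<forall>p\<in>long_paths n. weighted_length \<omega> p \<le> C * real n + M \<and>
        real n \<le> t * weighted_length \<omega> p + M))"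

lemma regularE:
  assumes "regular \<omega>"
  obtains C t M where "0 \<le> C" "0 \<le> t" "0 \<le> M"
    "\<forall>x y p. path_between V E x y p \<longrightarrow> distinct p \<longrightarrow> dist_V base x \<le> path_length p \<longrightarrow>
      weighted_length \<omega> p \<le> C * real (path_length p) + M \<and>
      real (path_length p) \<le> t * weighted_length \<omega> p + M"
proof -
  obtain C t M where *: "0 \<le> C" "0 \<le> t" "0 \<le> M"
     "\<And>n p. p \<in> long_paths n \<Longrightarrow> weighted_length \<omega> p \<le> C * real n + M \<and>
        real n \<le> t * weighted_length \<omega> p + M"
    using assms unfolding regular_def by auto
  have "p \<in> long_paths (path_length p)"
    if "path_between V E x y p" "distinct p" "dist_V base x \<le> path_length p" for x y p
    using that by (auto simp: long_paths_def path_between_def)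
  then show thesis using that[OF *(1-3)] *(4) by blast
qed

lemma regular_pos: "regular \<omega> \<Longrightarrow> \<forall>e\<in>E. 0 < \<omega> e"
  by (simp add: regular_def)

lemma regular_nonneg: "regular \<omega> \<Longrightarrow> \<forall>e\<in>E. 0 \<le> \<omega> e"
  using regular_pos by (auto intro: less_imp_le)

text \<open>The lower bound on weighted lengths leaves only finitely many simple paths from x that are
  no longer than a given competitor, so a minimum is attained.\<close>
lemma weighted_geodesic_exists:
  assumes \<omega>: "regular \<omega>" and xy: "x \<in> V" "y \<in> V"
  shows "\<exists>p. weighted_geodesic_between V E \<omega> x y p"
proof -
  obtain C t M where M: "0 \<le> C" "0 \<le> t" "0 \<le> M"
    "\<forall>x y p. path_between V E x y p \<longrightarrow> distinct p \<longrightarrow> dist_V base x \<le> path_length p \<longrightarrow>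
      weighted_length \<omega> p \<le> C * real (path_length p) + M \<and>
      real (path_length p) \<le> t * weighted_length \<omega> p + M"
    using regularE[OF \<omega>] by blast
  obtain p0 where p0: "path_between V E x y p0" using path_exists xy by blast
  let ?W = "weighted_length \<omega> p0"
  let ?S = "{q. path_between V E x y q \<and> distinct q \<and> weighted_length \<omega> q \<le> ?W}"
  let ?N = "max (dist_V base x) (nat \<lceil>t * ?W + M\<rceil>)"
  have "?S \<subseteq> (\<Union>n\<le>?N. walks x n)"
  proof
    fix q assume q: "q \<in> ?S"
    have "path_length q \<le> ?N"
    proof (cases "dist_V base x \<le> path_length q")
      case True
      then have "real (path_length q) \<le> t * weighted_length \<omega> q + M" using M(4) q by blast
      also have "\<dots> \<le> t * ?W + M" using M(2) q by (auto intro: mult_left_mono)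
      finally show ?thesis by linarith
    qed simp
    then show "q \<in> (\<Union>n\<le>?N. walks x n)" using q by (auto simp: walks_def path_between_def)
  qed
  then have fin: "finite ?S" by (rule finite_subset) (use walks[OF xy(1)] in auto)
  obtain q0 where "q0 \<in> ?S" using loop_erasure[OF regular_nonneg[OF \<omega>] p0] by auto
  then have ne: "?S \<noteq> {}" by blast
  define q where "q = arg_min_on (weighted_length \<omega>) ?S"
  have q: "q \<in> ?S" "\<And>r. r \<in> ?S \<Longrightarrow> weighted_length \<omega> q \<le> weighted_length \<omega> r"
    using arg_min_if_finite[OF fin ne, of "weighted_length \<omega>"] unfolding q_def not_less[symmetric] by blast+
  have "weighted_length \<omega> q \<le> weighted_length \<omega> r" if r: "path_between V E x y r" for r
  proof (cases "weighted_length \<omega> r \<le> ?W")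
    case True
    obtain r' where r': "path_between V E x y r'" "distinct r'"
        "weighted_length \<omega> r' \<le> weighted_length \<omega> r"
      using loop_erasure[OF regular_nonneg[OF \<omega>] r] by blast
    then have "r' \<in> ?S" using True by simp
    then show ?thesis using q(2) r'(3) by fastforce
  qed (use q(1) in auto)
  then show ?thesis using q(1) weighted_geodesic_iff[OF regular_nonneg[OF \<omega>]] by blast
qed

text \<open>Between two visits to the ball of radius j about the base, a weighted geodesic is no
  longer than the detour through the base, whose weighted length is linear in j. If it has
  more than j edges there, regularity bounds their number linearly in that length.\<close>
lemma weighted_geodesic_sparse:
  assumes \<omega>: "regular \<omega>"
  obtains \<alpha> \<beta> :: real where "0 \<le> \<alpha>" "\<And>x y p j. weighted_geodesic_between V E \<omega> x y p \<Longrightarrow>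
    real (card {i. i < path_length p \<and> dist_V base (p ! i) \<le> j}) \<le> \<alpha> * real j + \<beta>"
proof -
  obtain C t M where M: "0 \<le> C" "0 \<le> t" "0 \<le> M"
    "\<forall>x y p. path_between V E x y p \<longrightarrow> distinct p \<longrightarrow> dist_V base x \<le> path_length p \<longrightarrow>
      weighted_length \<omega> p \<le> C * real (path_length p) + M \<and>
      real (path_length p) \<le> t * weighted_length \<omega> p + M"
    using regularE[OF \<omega>] by blast
  note nonneg = regular_nonneg[OF \<omega>]
  define L where "L j = (1 + 2 * t * C) * real j + (2 * t * M + M)" for j :: nat
  have to_base: "\<exists>q. path_between V E base u q \<and> weighted_length \<omega> q \<le> C * real j + M"
    if "u \<in> V" "dist_V base u \<le> j" for u j
  proof -
    obtain q where q: "path_between V E base u q" "path_length q = dist_V base u"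
      using shortest_path[OF base \<open>u \<in> V\<close>] by blast
    have "weighted_length \<omega> q \<le> C * real (path_length q) + M"
      using M(4)[rule_format, OF q(1) shortest_path_distinct[OF q]] q base by simp
    also have "\<dots> \<le> C * real j + M" using that q M(1) by (auto intro: mult_left_mono)
    finally show ?thesis using q by blast
  qed
  have "real (card {i. i < path_length p \<and> dist_V base (p ! i) \<le> j}) \<le> L j + 1"
    if g: "weighted_geodesic_between V E \<omega> x y p" for x y p j
  proof (rule card_le_of_spread)
    show "0 \<le> L j" using M unfolding L_def by (intro add_nonneg_nonneg mult_nonneg_nonneg) auto
    fix i i' assume "i \<in> {i. i < path_length p \<and> dist_V base (p ! i) \<le> j}"
      "i' \<in> {i. i < path_length p \<and> dist_V base (p ! i) \<le> j}" "i < i'"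
    then have i: "i \<le> i'" "i' \<le> path_length p" "dist_V base (p ! i) \<le> j" "dist_V base (p ! i') \<le> j"
      by auto
    have p: "path_between V E x y p" using g by (simp add: weighted_geodesic_between_def)
    let ?q = "drop i (take (Suc i') p)"
    note sub = path_between_nths[OF p i(1,2)]
    show "real (i' - i) \<le> L j"
    proof (cases "i' - i \<le> j")
      case True
      have "real (i' - i) \<le> real j" using True by simp
      also have "\<dots> \<le> real j + (2 * t * C * real j + (2 * t * M + M))"
        using M by simp
      also have "\<dots> = L j" unfolding L_def by (simp add: algebra_simps)
      finally show ?thesis .
    next
      case False
      obtain r s where r: "path_between V E base (p ! i) r" "weighted_length \<omega> r \<le> C * real j + M"
        and s: "path_between V E base (p ! i') s" "weighted_length \<omega> s \<le> C * real j + M"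
        using to_base[OF path_between_nth(4)[OF p] i(3)] to_base[OF path_between_nth(4)[OF p] i(4)] i(1,2)
        by auto
      obtain w where w: "path_between V E (p ! i) (p ! i') w"
        "\<And>\<omega>. weighted_length \<omega> w = weighted_length \<omega> (rev r) + weighted_length \<omega> s"
        using path_between_join[OF path_between_rev[OF r(1)] s(1)] by metis
      have "weighted_length \<omega> ?q \<le> weighted_length \<omega> w"
        using weighted_geodesic_nths[OF nonneg g i(1,2)] w(1)
        unfolding weighted_geodesic_iff[OF nonneg] by blast
      also have "\<dots> \<le> 2 * (C * real j + M)" using w(2) r(2) s(2) by (simp add: weighted_length_rev)
      finally have q: "weighted_length \<omega> ?q \<le> 2 * (C * real j + M)" .
      have "distinct ?q" using weighted_geodesic_distinct[OF regular_pos[OF \<omega>] g] by simp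
      then have "real (i' - i) \<le> t * weighted_length \<omega> ?q + M"
        using M(4)[rule_format, OF sub(1)] sub(2) False i(3) by simp
      also have "t * weighted_length \<omega> ?q \<le> t * (2 * (C * real j + M))"
        using q M(2) by (rule mult_left_mono)
      finally show ?thesis unfolding L_def by (simp add: algebra_simps)
    qed
  qed simp
  then show thesis using M by (intro that[of "1 + 2 * t * C" "2 * t * M + M + 1"])
      (auto simp: L_def algebra_simps)
qed

text \<open>The chord from \<open>\<gamma> a\<close> to \<open>\<gamma> b\<close> has a point z at bounded distance from the base, so a path that
  is sparse about the base is sparse about z, and therefore passes near z.\<close>
lemma weighted_geodesics_meet_ball:
  assumes \<omega>: "regular \<omega>" and \<gamma>: "biinf_quasi_geodesic V E \<gamma>"
  obtains R where "\<And>a b p. \<lbrakk>a \<le> 0; 0 \<le> b; weighted_geodesic_between V E \<omega> (\<gamma> a) (\<gamma> b) p\<rbrakk>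
    \<Longrightarrow> \<exists>v\<in>set p. v \<in> centred_ball R"
proof -
  have \<gamma>V: "\<gamma> i \<in> V" for i
    using \<gamma> biinf_path_in_V by (simp add: biinf_quasi_geodesic_def)
  obtain M where M: "\<And>a b. a \<le> 0 \<Longrightarrow> 0 \<le> b \<Longrightarrow>
      \<exists>z\<in>between (\<gamma> a) (\<gamma> b). dist_V (\<gamma> 0) z \<le> M"
    using quasi_geodesic_passes_near_geodesics[OF \<gamma>] by metis
  define K where "K = dist_V base (\<gamma> 0) + M"
  obtain \<alpha> \<beta> :: real where sparse: "0 \<le> \<alpha>"
      "\<And>x y p j. weighted_geodesic_between V E \<omega> x y p \<Longrightarrow>
        real (card {i. i < path_length p \<and> dist_V base (p ! i) \<le> j}) \<le> \<alpha> * real j + \<beta>"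
    using weighted_geodesic_sparse[OF \<omega>] by metis
  obtain R where R: "\<And>n v z. \<lbrakk>0 < n; \<And>i. i \<le> n \<Longrightarrow> v i \<in> V;
      \<And>i. i < n \<Longrightarrow> dist_V (v i) (v (Suc i)) \<le> 1; z \<in> between (v 0) (v n);
      \<And>j. real (card {i. i < n \<and> dist_V z (v i) \<le> j}) \<le> \<alpha> * real j + (\<alpha> * real K + \<beta>)\<rbrakk>
    \<Longrightarrow> \<exists>i<n. dist_V z (v i) \<le> R"
    using sparse_path_passes_near by blast
  have "\<exists>v\<in>set p. v \<in> centred_ball (K + R)"
    if ab: "a \<le> 0" "0 \<le> b" and g: "weighted_geodesic_between V E \<omega> (\<gamma> a) (\<gamma> b) p" for a b p
  proof -
    have p: "path_between V E (\<gamma> a) (\<gamma> b) p" using g by (simp add: weighted_geodesic_between_def)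
    note nth = path_between_nth[OF p]
    obtain z where z: "z \<in> between (\<gamma> a) (\<gamma> b)" "dist_V (\<gamma> 0) z \<le> M" using M ab by blast
    then have zV: "z \<in> V" by (simp add: between_def)
    have Kz: "dist_V base z \<le> K"
      using graph_dist_triangle[OF base \<gamma>V zV, of 0] z(2) unfolding K_def by linarith
    have near: "v \<in> centred_ball (K + j)" if "v \<in> V" "dist_V z v \<le> j" for v j
      using graph_dist_triangle[OF base zV that(1)] Kz that by (simp add: centred_ball_def)
    \<comment> \<open>The bound on sparse paths needs at least one edge; a path without edges starts at z itself.\<close>
    obtain i where i: "i \<le> path_length p" "dist_V z (p ! i) \<le> R"
    proof (cases "path_length p = 0")
      case True
      then have "dist_V (\<gamma> a) z = 0" using z(1) nth(1,2) \<gamma>V[of a] by (simp add: between_def)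
      then have "dist_V z (p ! 0) = 0" using nth(1) graph_dist_sym[OF zV \<gamma>V] by simp
      then show ?thesis using that[of 0] by simp
    next
      case False
      have "\<exists>i<path_length p. dist_V z (p ! i) \<le> R"
      proof (rule R)
        fix j
        have "card {i. i < path_length p \<and> dist_V z (p ! i) \<le> j}
            \<le> card {i. i < path_length p \<and> dist_V base (p ! i) \<le> K + j}"
          using near nth(4) by (intro card_mono) (auto simp: centred_ball_def)
        also have "real \<dots> \<le> \<alpha> * real (K + j) + \<beta>" by (rule sparse(2)[OF g])
        finally show "real (card {i. i < path_length p \<and> dist_V z (p ! i) \<le> j})
            \<le> \<alpha> * real j + (\<alpha> * real K + \<beta>)" by (simp add: algebra_simps)
      qed (use False nth z graph_dist_edge in auto)
      then show ?thesis using that less_imp_le by blast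
    qed
    then have "p ! i \<in> centred_ball (K + R)" using near nth(4) by blast
    then show ?thesis using i(1) nth(3) nth_mem[of i p] by auto
  qed
  then show thesis using that by blast
qed

end

section \<open>Bi-infinite geodesics by compactness\<close>

text \<open>Koenig's lemma: nested infinite sets on which one more coordinate is constant.\<close>
lemma pointwise_constant_on_infinite:
  fixes f :: "nat \<Rightarrow> nat \<Rightarrow> 'b"
  assumes "infinite N" and fin: "\<And>i. finite ((\<lambda>n. f n i) ` N)"
  obtains g where "\<And>k. infinite {n \<in> N. \<forall>i<k. f n i = g i}"
proof -
  have "\<exists>S. \<forall>k. (infinite (S k) \<and> S k \<subseteq> N) \<and>
      (S (Suc k) \<subseteq> S k \<and> (\<exists>v. \<forall>n\<in>S (Suc k). f n k = v))"
  proof (rule dependent_nat_choice)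
    show "\<exists>S. infinite S \<and> S \<subseteq> N" using assms(1) by blast
  next
    fix S k assume S: "infinite S \<and> S \<subseteq> N"
    have "finite ((\<lambda>n. f n k) ` S)" using fin[of k] S finite_subset image_mono by metis
    then obtain n where "infinite {m \<in> S. f m k = f n k}"
      using pigeonhole_infinite[of S "\<lambda>n. f n k"] S by blast
    then show "\<exists>T. (infinite T \<and> T \<subseteq> N) \<and> (T \<subseteq> S \<and> (\<exists>v. \<forall>n\<in>T. f n k = v))"
      using S by (intro exI[of _ "{m \<in> S. f m k = f n k}"]) auto
  qed
  then obtain S where *: "\<forall>k. (infinite (S k) \<and> S k \<subseteq> N) \<and>
      (S (Suc k) \<subseteq> S k \<and> (\<exists>v. \<forall>n\<in>S (Suc k). f n k = v))"
    by (rule exE)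
  have S: "infinite (S k)" "S k \<subseteq> N" "S (Suc k) \<subseteq> S k" for k using * by blast+
  from * have "\<forall>k. \<exists>v. \<forall>n\<in>S (Suc k). f n k = v" by blast
  then obtain g where g: "\<And>k n. n \<in> S (Suc k) \<Longrightarrow> f n k = g k" by metis
  have sub: "S k \<subseteq> {n \<in> N. \<forall>i<k. f n i = g i}" for k
  proof
    fix n assume n: "n \<in> S k"
    have "f n i = g i" if "i < k" for i
      using g[of n i] n lift_Suc_antimono_le[of S "Suc i" k] S(3) that by auto
    then show "n \<in> {n \<in> N. \<forall>i<k. f n i = g i}" using n S(2) by blast
  qed
  show thesis
    by (rule that[of g]) (use finite_subset[OF sub] S(1) in blast)
qed

context fpp_graph
begin

text \<open>The weighted geodesics between \<open>\<gamma> (- n)\<close> and \<open>\<gamma> n\<close> all cross one finite ball, infinitely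
  many of them in the same vertex a. Indexed so that they are at a at time 0, they run for at
  least \<open>n - d (\<gamma> 0, a)\<close> steps in both directions and take finitely many values at each time.
  A pointwise limit agrees on every window with some of them, and is a geodesic since their
  subpaths are.\<close>
lemma weighted_biinf_geodesic_exists:
  assumes \<omega>: "regular \<omega>" and \<gamma>: "biinf_geodesic V E \<gamma>"
  shows "\<exists>\<gamma>'. weighted_biinf_geodesic V E \<omega> \<gamma>'"
proof -
  have dist_\<gamma>: "int (dist_V (\<gamma> i) (\<gamma> j)) = j - i" if "i < j" for i j
    using \<gamma> that by (simp add: biinf_geodesic_def)
  have "biinf_quasi_geodesic V E \<gamma>"
    unfolding biinf_quasi_geodesic_def
  proof (rule conjI, goal_cases path qi)
    case path
    show ?case using \<gamma> by (simp add: biinf_geodesic_def)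
  next
    case qi
    have "real_of_int (j - i) \<le> 1 * real (dist_V (\<gamma> i) (\<gamma> j)) + 0" if "i < j" for i j
      using dist_\<gamma>[OF that] by linarith
    then show ?case by (intro exI[of _ "1::real"] exI[of _ "0::real"]) auto
  qed
  then obtain R where R: "\<And>a b p. \<lbrakk>a \<le> 0; 0 \<le> b; weighted_geodesic_between V E \<omega> (\<gamma> a) (\<gamma> b) p\<rbrakk>
      \<Longrightarrow> \<exists>v\<in>set p. v \<in> centred_ball R"
    using weighted_geodesics_meet_ball[OF \<omega>] by blast
  have \<gamma>V: "\<gamma> i \<in> V" for i using \<gamma> biinf_path_in_V by (simp add: biinf_geodesic_def)
  note nonneg = regular_nonneg[OF \<omega>]
  have "\<exists>p m. weighted_geodesic_between V E \<omega> (\<gamma> (- int n)) (\<gamma> (int n)) p \<and>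
      m \<le> path_length p \<and> p ! m \<in> centred_ball R" for n
  proof -
    obtain p where p: "weighted_geodesic_between V E \<omega> (\<gamma> (- int n)) (\<gamma> (int n)) p"
      using weighted_geodesic_exists[OF \<omega> \<gamma>V \<gamma>V] by blast
    then have "length p = Suc (path_length p)"
      unfolding weighted_geodesic_between_def by (rule path_between_nth(3)[OF conjunct1])
    moreover obtain v where "v \<in> set p" "v \<in> centred_ball R" using R[OF _ _ p] by auto
    ultimately show ?thesis using p by (metis in_set_conv_nth less_Suc_eq_le)
  qed
  then obtain p m where p: "\<And>n. weighted_geodesic_between V E \<omega> (\<gamma> (- int n)) (\<gamma> (int n)) (p n)"
    and m: "\<And>n. m n \<le> path_length (p n)" "\<And>n. p n ! m n \<in> centred_ball R"
    by metis
  have path: "path_between V E (\<gamma> (- int n)) (\<gamma> (int n)) (p n)" for n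
    using p by (simp add: weighted_geodesic_between_def)
  have inV: "p n ! i \<in> V" if "i \<le> path_length (p n)" for n i
    using path_between_nth(4)[OF path] that .
  have "(\<lambda>n. p n ! m n) ` UNIV \<subseteq> centred_ball R" using m(2) by auto
  then have "finite ((\<lambda>n. p n ! m n) ` UNIV)" using centred_ball finite_subset by blast
  then obtain n0 where "infinite {n \<in> UNIV. p n ! m n = p n0 ! m n0}"
    using pigeonhole_infinite[of UNIV "\<lambda>n. p n ! m n"] by auto
  then obtain a N where N: "infinite N" "\<And>n. n \<in> N \<Longrightarrow> p n ! m n = a" and aV: "a \<in> V"
    using inV m(1) by (metis (mono_tags, lifting) mem_Collect_eq)
  define c where "c = dist_V (\<gamma> 0) a"
  have window: "n \<le> m n + c" "n + m n \<le> path_length (p n) + c" if "n \<in> N" for n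
  proof -
    have "dist_V (\<gamma> (- int n)) a \<le> m n"
      using path_steps[OF path[of n], of 0 "m n"] m(1) N(2)[OF that] path_between_nth(1)[OF path[of n]]
      by simp
    moreover have "dist_V (\<gamma> (- int n)) (\<gamma> 0) = n" using dist_\<gamma>[of "- int n" 0] \<gamma>V by (cases n) auto
    ultimately show "n \<le> m n + c"
      using graph_dist_triangle[OF \<gamma>V aV \<gamma>V, of "- int n" 0] graph_dist_sym[OF \<gamma>V aV, of 0]
      unfolding c_def by linarith
    have "dist_V a (\<gamma> (int n)) \<le> path_length (p n) - m n"
      using path_steps[OF path[of n], of "m n" "path_length (p n)"] m(1) N(2)[OF that]
        path_between_nth(2)[OF path[of n]] by simp
    moreover have "dist_V (\<gamma> 0) (\<gamma> (int n)) = n" using dist_\<gamma>[of 0 "int n"] \<gamma>V by (cases n) auto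
    ultimately show "n + m n \<le> path_length (p n) + c"
      using graph_dist_triangle[OF \<gamma>V aV \<gamma>V, of 0 "int n"] m(1)[of n] unfolding c_def by linarith
  qed
  \<comment> \<open>Outside the window of times at which \<open>p n\<close> is defined, \<open>f n\<close> takes arbitrary values.\<close>
  define f where "f n i = p n ! nat (int (m n) + i)" for n and i :: int
  have fin: "finite ((\<lambda>n. f n i) ` N)" for i
  proof -
    let ?r = "dist_V base a + nat \<bar>i\<bar>"
    have in_ball: "f n i \<in> centred_ball ?r" if n: "n \<in> N" "nat \<bar>i\<bar> + c < n" for n
    proof -
      let ?k = "nat (int (m n) + i)"
      have k: "?k \<le> path_length (p n)" using window[OF n(1)] n(2) by linarith
      have "dist_V a (p n ! ?k) \<le> nat \<bar>i\<bar>"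
      proof (cases "0 \<le> i")
        case True
        then show ?thesis
          using path_steps[OF path[of n], of "m n" ?k] k N(2)[OF n(1)] by (simp add: nat_add_distrib)
      next
        case False
        have "dist_V (p n ! ?k) (p n ! m n) \<le> m n - ?k"
          using path_steps[OF path[of n], of ?k "m n"] m(1) False by simp
        also have "\<dots> \<le> nat \<bar>i\<bar>" using False by linarith
        finally show ?thesis using N(2)[OF n(1)] graph_dist_sym[OF aV inV[OF k]] by simp
      qed
      then show ?thesis
        using graph_dist_triangle[OF base aV inV[OF k]] inV[OF k]
        by (simp add: centred_ball_def f_def)
    qed
    have "(\<lambda>n. f n i) ` N \<subseteq> centred_ball ?r \<union> (\<lambda>n. f n i) ` {..nat \<bar>i\<bar> + c}"
    proof (rule image_subsetI)
      fix n assume "n \<in> N"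
      then show "f n i \<in> centred_ball ?r \<union> (\<lambda>n. f n i) ` {..nat \<bar>i\<bar> + c}"
        using in_ball[of n] by (cases "nat \<bar>i\<bar> + c < n") auto
    qed
    moreover have "finite (centred_ball ?r \<union> (\<lambda>n. f n i) ` {..nat \<bar>i\<bar> + c})"
      using centred_ball by auto
    ultimately show ?thesis by (rule finite_subset)
  qed
  obtain g' where g': "\<And>k. infinite {n \<in> N. \<forall>i<k. f n (int_decode i) = g' i}"
    using pointwise_constant_on_infinite[OF N(1), of "\<lambda>n i. f n (int_decode i)"] fin by blast
  define g where "g i = g' (int_encode i)" for i
  have agree: "\<exists>n\<in>N. K < n \<and> (\<forall>i\<in>I. f n i = g i)" if I: "finite I" for I K
  proof -
    obtain k where "\<forall>i\<in>I. int_encode i < k"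
      using finite_nat_set_iff_bounded[THEN iffD1, OF finite_imageI[OF I, of int_encode]] by auto
    then have "{n \<in> N. \<forall>i<k. f n (int_decode i) = g' i} \<subseteq> {n \<in> N. \<forall>i\<in>I. f n i = g i}"
      unfolding g_def by (auto dest: spec[of _ "int_encode _"])
    then have "infinite {n \<in> N. \<forall>i\<in>I. f n i = g i}" using g' finite_subset by blast
    then show ?thesis unfolding infinite_nat_iff_unbounded by blast
  qed
  have "weighted_biinf_geodesic V E \<omega> g"
    unfolding weighted_biinf_geodesic_def biinf_path_def
  proof (intro conjI allI impI)
    fix i
    obtain n where n: "n \<in> N" "nat \<bar>i\<bar> + nat \<bar>i + 1\<bar> + c < n" "f n i = g i" "f n (i + 1) = g (i + 1)"
      using agree[of "{i, i + 1}"] by auto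
    have "nat (int (m n) + i) < path_length (p n)" "nat (int (m n) + (i + 1)) = Suc (nat (int (m n) + i))"
      using window[OF n(1)] n(2) by linarith+
    then show "{g i, g (i + 1)} \<in> E"
      using path_between_nth(5)[OF path[of n]] n(3,4) unfolding f_def by metis
  next
    fix i j :: int assume ij: "i < j"
    obtain n where n: "n \<in> N" "nat \<bar>i\<bar> + nat \<bar>j\<bar> + c < n" "\<forall>k\<in>{i..j}. f n k = g k"
      using agree[of "{i..j}"] by auto
    define i' j' where "i' = nat (int (m n) + i)" and "j' = nat (int (m n) + j)"
    have le: "i' \<le> j'" "j' \<le> path_length (p n)" "int i' = int (m n) + i" "int j' = int (m n) + j"
      using window[OF n(1)] n(2) ij unfolding i'_def j'_def by linarith+
    have len: "j' < length (p n)" using le(2) path_between_nth(3)[OF path[of n]] by simp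
    have gi: "p n ! k = g (int k - int (m n))" if "i' \<le> k" "k \<le> j'" for k
      using n(3)[rule_format, of "int k - int (m n)"] that le unfolding f_def by simp
    have "(\<Sum>k\<in>{i..<j}. \<omega> {g k, g (k + 1)}) = (\<Sum>k=i'..<j'. \<omega> {p n ! k, p n ! Suc k})"
    proof (rule sum.reindex_bij_witness[of _ "\<lambda>k. int k - int (m n)" "\<lambda>k. nat (int (m n) + k)"])
      fix k assume k: "k \<in> {i..<j}"
      then have "int (nat (int (m n) + k)) = int (m n) + k" using le by auto
      moreover have "i' \<le> nat (int (m n) + k)" "Suc (nat (int (m n) + k)) \<le> j'"
        using k le by auto
      ultimately show "\<omega> {p n ! nat (int (m n) + k), p n ! Suc (nat (int (m n) + k))} = \<omega> {g k, g (k + 1)}"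
        using gi[of "nat (int (m n) + k)"] gi[of "Suc (nat (int (m n) + k))"]
        by (simp add: add.commute)
    qed (use le in auto)
    also have "\<dots> = weighted_length \<omega> (drop i' (take (Suc j') (p n)))"
      using weighted_length_nths[OF len le(1)] by simp
    also have "\<dots> = weighted_dist V E \<omega> (p n ! i') (p n ! j')"
      using weighted_geodesic_nths[OF nonneg p le(1,2)] by (simp add: weighted_geodesic_between_def)
    also have "\<dots> = weighted_dist V E \<omega> (g i) (g j)" using gi[of i'] gi[of j'] le by simp
    finally show "(\<Sum>k\<in>{i..<j}. \<omega> {g k, g (k + 1)}) = weighted_dist V E \<omega> (g i) (g j)" .
  qed
  then show ?thesis by blast
qed

text \<open>The finitely many pairs that are not yet on opposite sides of \<open>\<gamma> 0\<close> are dealt with by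
  adding their first vertices to the ball.\<close>
lemma weighted_geodesics_meet_finite_set:
  assumes \<omega>: "regular \<omega>" and \<gamma>: "biinf_quasi_geodesic V E \<gamma>"
    and xy: "\<And>n. x n = \<gamma> (s n) \<and> y n = \<gamma> (t n)"
    and st: "filterlim s at_bot sequentially" "filterlim t at_top sequentially"
  shows "\<exists>A. finite A \<and> A \<subseteq> V \<and>
    (\<forall>n. (\<exists>p. weighted_geodesic_between V E \<omega> (x n) (y n) p) \<and>
      (\<forall>p. weighted_geodesic_between V E \<omega> (x n) (y n) p \<longrightarrow> set p \<inter> A \<noteq> {}))"
proof -
  have \<gamma>V: "\<gamma> i \<in> V" for i
    using \<gamma> biinf_path_in_V by (simp add: biinf_quasi_geodesic_def)
  obtain R where R: "\<And>a b p. \<lbrakk>a \<le> 0; 0 \<le> b; weighted_geodesic_between V E \<omega> (\<gamma> a) (\<gamma> b) p\<rbrakk>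
      \<Longrightarrow> \<exists>v\<in>set p. v \<in> centred_ball R"
    using weighted_geodesics_meet_ball[OF \<omega> \<gamma>] by blast
  have "eventually (\<lambda>n. s n \<le> 0 \<and> 0 \<le> t n) sequentially"
    using st by (intro eventually_conj) (auto simp: filterlim_at_bot filterlim_at_top)
  then obtain n0 where n0: "\<And>n. n0 \<le> n \<Longrightarrow> s n \<le> 0 \<and> 0 \<le> t n"
    unfolding eventually_sequentially by blast
  let ?A = "centred_ball R \<union> x ` {..<n0}"
  show ?thesis
  proof (intro exI[of _ ?A] conjI allI impI)
    show "finite ?A" using centred_ball by simp
    show "?A \<subseteq> V" using xy \<gamma>V by (auto simp: centred_ball_def)
    show "\<exists>p. weighted_geodesic_between V E \<omega> (x n) (y n) p" for n
      using weighted_geodesic_exists[OF \<omega> \<gamma>V \<gamma>V] xy by metis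
    fix n p assume p: "weighted_geodesic_between V E \<omega> (x n) (y n) p"
    show "set p \<inter> ?A \<noteq> {}"
    proof (cases "n < n0")
      case True
      have "x n \<in> set p"
        using p hd_in_set unfolding weighted_geodesic_between_def path_between_def by metis
      then show ?thesis using True by blast
    next
      case False
      then show ?thesis using R[of "s n" "t n" p] n0[of n] p xy by fastforce
    qed
  qed
qed

end

section \<open>Almost every weight is regular\<close>

lemma nn_integral_prod_coordinates:
  assumes "prob_space \<nu>" "finite J" "J \<subseteq> I" and [measurable]: "f \<in> borel_measurable \<nu>"
  shows "(\<integral>\<^sup>+\<omega>. (\<Prod>e\<in>J. f (\<omega> e)) \<partial>Pi\<^sub>M I (\<lambda>_. \<nu>)) = (\<integral>\<^sup>+x. f x \<partial>\<nu>) ^ card J"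
proof -
  interpret \<nu>: prob_space \<nu> by fact
  interpret product_prob_space "\<lambda>_. \<nu>" I by unfold_locales
  have "(\<integral>\<^sup>+\<omega>. (\<Prod>e\<in>J. f (\<omega> e)) \<partial>Pi\<^sub>M I (\<lambda>_. \<nu>))
      = (\<integral>\<^sup>+\<omega>. (\<Prod>e\<in>J. f (restrict \<omega> J e)) \<partial>Pi\<^sub>M I (\<lambda>_. \<nu>))"
    by (intro nn_integral_cong prod.cong) auto
  also have "\<dots> = (\<integral>\<^sup>+\<omega>. (\<Prod>e\<in>J. f (\<omega> e)) \<partial>distr (Pi\<^sub>M I (\<lambda>_. \<nu>)) (Pi\<^sub>M J (\<lambda>_. \<nu>)) (\<lambda>\<omega>. restrict \<omega> J))"
    using assms(3) by (intro nn_integral_distr[symmetric] measurable_restrict_subset) auto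
  also have "\<dots> = (\<integral>\<^sup>+\<omega>. (\<Prod>e\<in>J. f (\<omega> e)) \<partial>Pi\<^sub>M J (\<lambda>_. \<nu>))"
    using assms by (subst distr_PiM_restrict_finite) auto
  also have "\<dots> = (\<integral>\<^sup>+x. f x \<partial>\<nu>) ^ card J"
    using assms by (subst product_nn_integral_prod) auto
  finally show ?thesis .
qed

text \<open>A union bound without Borel-Cantelli: the sum of all the variables has finite expectation,
  hence is almost surely finite, and it bounds each of them.\<close>
lemma AE_bounded_over_families:
  fixes X :: "'i \<Rightarrow> 'a \<Rightarrow> ennreal" and K :: nat and q :: real
  assumes fin: "\<And>n. finite (A n)" and card: "\<And>n. card (A n) \<le> K ^ n"
    and meas: "\<And>n a. a \<in> A n \<Longrightarrow> X a \<in> borel_measurable M"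
    and int: "\<And>n a. a \<in> A n \<Longrightarrow> (\<integral>\<^sup>+\<omega>. X a \<omega> \<partial>M) \<le> ennreal (q ^ n)"
    and q: "0 \<le> q" "real K * q \<le> 1 / 2"
  shows "AE \<omega> in M. \<exists>S\<ge>0. \<forall>n. \<forall>a\<in>A n. X a \<omega> \<le> ennreal S"
proof -
  define F where "F n \<omega> = (\<Sum>a\<in>A n. X a \<omega>)" for n \<omega>
  have [measurable]: "F n \<in> borel_measurable M" for n
    unfolding F_def using meas by (intro borel_measurable_sum) auto
  have "(\<integral>\<^sup>+\<omega>. F n \<omega> \<partial>M) \<le> ennreal ((1 / 2) ^ n)" for n
  proof -
    have "(\<integral>\<^sup>+\<omega>. F n \<omega> \<partial>M) = (\<Sum>a\<in>A n. \<integral>\<^sup>+\<omega>. X a \<omega> \<partial>M)"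
      unfolding F_def using meas by (intro nn_integral_sum)
    also have "\<dots> \<le> (\<Sum>a\<in>A n. ennreal (q ^ n))" using int by (rule sum_mono)
    also have "\<dots> = ennreal (real (card (A n)) * q ^ n)"
      using q by (simp add: ennreal_mult ennreal_of_nat_eq_real_of_nat)
    also have "\<dots> \<le> ennreal ((1 / 2) ^ n)"
    proof (rule ennreal_leI)
      have "real (card (A n)) \<le> real K ^ n" using card[of n] by (metis of_nat_mono of_nat_power)
      then have "real (card (A n)) * q ^ n \<le> (real K * q) ^ n"
        using q unfolding power_mult_distrib by (intro mult_right_mono) auto
      also have "\<dots> \<le> (1 / 2) ^ n" using q by (intro power_mono) auto
      finally show "real (card (A n)) * q ^ n \<le> (1 / 2) ^ n" .
    qed
    finally show ?thesis .
  qed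
  then have "(\<Sum>n. \<integral>\<^sup>+\<omega>. F n \<omega> \<partial>M) \<le> (\<Sum>n. ennreal ((1 / 2) ^ n))"
    by (intro suminf_le) auto
  also have "\<dots> = ennreal (\<Sum>n. (1 / 2) ^ n)"
    by (intro suminf_ennreal2) (auto intro: summable_geometric)
  also have "\<dots> < \<top>" by simp
  finally have "(\<integral>\<^sup>+\<omega>. (\<Sum>n. F n \<omega>) \<partial>M) \<noteq> \<infinity>"
    by (subst nn_integral_suminf) auto
  then have "AE \<omega> in M. (\<Sum>n. F n \<omega>) \<noteq> \<infinity>"
    by (intro nn_integral_PInf_AE) auto
  then show ?thesis
  proof (rule AE_mp, intro AE_I2 impI)
    fix \<omega> assume fin_sum: "(\<Sum>n. F n \<omega>) \<noteq> \<infinity>"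
    have "X a \<omega> \<le> (\<Sum>n. F n \<omega>)" if "a \<in> A n" for n a
    proof -
      have "X a \<omega> \<le> F n \<omega>" unfolding F_def using fin that by (intro member_le_sum) auto
      also have "\<dots> = (\<Sum>k\<in>{n}. F k \<omega>)" by simp
      also have "\<dots> \<le> (\<Sum>n. F n \<omega>)" by (rule sum_le_suminf) auto
      finally show ?thesis .
    qed
    moreover have "(\<Sum>n. F n \<omega>) = ennreal (enn2real (\<Sum>n. F n \<omega>))"
      using fin_sum by (simp add: less_top)
    ultimately show "\<exists>S\<ge>0. \<forall>n. \<forall>a\<in>A n. X a \<omega> \<le> ennreal S"
      by (intro exI[of _ "enn2real (\<Sum>n. F n \<omega>)"]) auto
  qed
qed

text \<open>Simple paths traverse different edges, so their edge weights are independent.\<close>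
lemma distinct_path_edges:
  assumes "distinct p"
  shows "inj_on (\<lambda>i. {p ! i, p ! Suc i}) {..<path_length p}"
proof (rule inj_onI)
  fix i j assume ij: "i \<in> {..<path_length p}" "j \<in> {..<path_length p}"
    and eq: "{p ! i, p ! Suc i} = {p ! j, p ! Suc j}"
  have lt: "i < length p" "Suc i < length p" "j < length p" "Suc j < length p"
    using ij by (auto simp: path_length_def)
  have "p ! i = p ! j \<or> p ! i = p ! Suc j \<and> p ! Suc i = p ! j"
    using eq by (auto simp: doubleton_eq_iff)
  then show "i = j" using nth_eq_iff_index_eq[OF assms] lt by auto
qed

context fpp_graph
begin

text \<open>Exponentials turn the linear bound into a product over independent edges. With q as small
  as required, the expectations \<open>q ^ n\<close> beat the number of paths with n edges. For
  \<open>a > 0\<close> this bounds weighted lengths above, for \<open>a < 0 < b\<close> it bounds them below.\<close>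
lemma AE_long_paths_bound:
  fixes \<nu> :: "real measure" and a b q :: real
  assumes "prob_space \<nu>" and [measurable]: "(\<lambda>x. x) \<in> borel_measurable \<nu>"
    and int: "(\<integral>\<^sup>+x. ennreal (exp (a * x + b)) \<partial>\<nu>) \<le> ennreal q"
    and q: "0 \<le> q" "real ((D + 1) * D) * q \<le> 1 / 2"
  shows "AE \<omega> in fpp_measure E \<nu>. \<exists>S\<ge>0. \<forall>n. \<forall>p\<in>long_paths n.
    a * weighted_length \<omega> p + b * real n \<le> S"
proof -
  define edges where "edges p = (\<lambda>i. {p ! i, p ! Suc i}) ` {..<path_length p}" for p :: "'a list"
  define X where "X p \<omega> = (\<Prod>e\<in>edges p. ennreal (exp (a * \<omega> e + b)))" for p and \<omega> :: "'a set \<Rightarrow> real"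
  have fin: "finite (edges p)" for p by (simp add: edges_def)
  have sub: "edges p \<subseteq> E" and card: "card (edges p) = n" if "p \<in> long_paths n" for p n
  proof -
    have p: "path_between V E (hd p) (last p) p" "distinct p" "path_length p = n"
      using that by (auto simp: long_paths_def)
    show "edges p \<subseteq> E" using path_between_nth(5)[OF p(1)] by (auto simp: edges_def)
    show "card (edges p) = n"
      unfolding edges_def using card_image[OF distinct_path_edges[OF p(2)]] p(3) by simp
  qed
  have X: "X p \<omega> = ennreal (exp (a * weighted_length \<omega> p + b * real n))" if "p \<in> long_paths n" for p n \<omega>
  proof -
    have p: "distinct p" "path_length p = n" using that by (auto simp: long_paths_def)
    have "X p \<omega> = (\<Prod>i<n. ennreal (exp (a * \<omega> {p ! i, p ! Suc i} + b)))"
      unfolding X_def edges_def using prod.reindex[OF distinct_path_edges[OF p(1)]] p(2) by simp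
    also have "\<dots> = ennreal (exp (\<Sum>i<n. a * \<omega> {p ! i, p ! Suc i} + b))"
      by (simp add: prod_ennreal exp_sum)
    also have "(\<Sum>i<n. a * \<omega> {p ! i, p ! Suc i} + b) = a * weighted_length \<omega> p + b * real n"
      using p(2) by (simp add: weighted_length_def sum.distrib sum_distrib_left)
    finally show ?thesis .
  qed
  have "AE \<omega> in fpp_measure E \<nu>. \<exists>S\<ge>0. \<forall>n. \<forall>p\<in>long_paths n. X p \<omega> \<le> ennreal S"
  proof (rule AE_bounded_over_families[where K = "(D + 1) * D" and q = q])
    fix n p assume p: "p \<in> long_paths n"
    have [measurable]: "(\<lambda>\<omega>. \<omega> e) \<in> borel_measurable (fpp_measure E \<nu>)" if "e \<in> edges p" for e
      using measurable_compose[OF measurable_component_singleton[of e E "\<lambda>_. \<nu>"] assms(2)] sub[OF p] that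
      by auto
    show "X p \<in> borel_measurable (fpp_measure E \<nu>)"
      unfolding X_def by measurable
    have "(\<integral>\<^sup>+\<omega>. X p \<omega> \<partial>fpp_measure E \<nu>) = (\<integral>\<^sup>+x. ennreal (exp (a * x + b)) \<partial>\<nu>) ^ n"
      unfolding X_def
      using nn_integral_prod_coordinates[OF assms(1) fin sub[OF p],
          of "\<lambda>x. ennreal (exp (a * x + b))"] card[OF p] by simp
    also have "\<dots> \<le> ennreal q ^ n" using int by (intro power_mono) auto
    finally show "(\<integral>\<^sup>+\<omega>. X p \<omega> \<partial>fpp_measure E \<nu>) \<le> ennreal (q ^ n)"
      using q by (simp add: ennreal_power)
  qed (use long_paths q in auto)
  then show ?thesis
  proof (rule AE_mp, intro AE_I2 impI)
    fix \<omega> assume "\<exists>S\<ge>0. \<forall>n. \<forall>p\<in>long_paths n. X p \<omega> \<le> ennreal S"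
    then obtain S where S: "0 \<le> S" "\<And>n p. p \<in> long_paths n \<Longrightarrow> X p \<omega> \<le> ennreal S" by blast
    have "a * weighted_length \<omega> p + b * real n \<le> S" if "p \<in> long_paths n" for n p
    proof -
      have "exp (a * weighted_length \<omega> p + b * real n) \<le> S"
        using S(2)[OF that] X[OF that] S(1) by simp
      then show ?thesis using exp_ge_add_one_self[of "a * weighted_length \<omega> p + b * real n"] by linarith
    qed
    then show "\<exists>S\<ge>0. \<forall>n. \<forall>p\<in>long_paths n. a * weighted_length \<omega> p + b * real n \<le> S"
      using S(1) by blast
  qed
qed

text \<open>The upper bound comes from the exponential moment, reduced below q by a factor
  \<open>exp (- l)\<close>. The lower bound comes from the expectation of \<open>exp (- k * x + 1)\<close>, which tends to
  0 as k grows because there is no mass at 0.\<close>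
lemma AE_regular:
  fixes \<nu> :: "real measure"
  assumes "prob_space \<nu>" and sets: "sets \<nu> = sets (restrict_space borel {0..})"
    and zero: "measure \<nu> {0} = 0"
    and c: "0 < c" "e \<in> E" "integrable (fpp_measure E \<nu>) (\<lambda>\<omega>. exp (c * \<omega> e))"
  shows "AE \<omega> in fpp_measure E \<nu>. regular \<omega>"
proof -
  interpret P: prob_space \<nu> by fact
  have space: "space \<nu> = {0..}" using sets_eq_imp_space_eq[OF sets] by (simp add: space_restrict_space)
  have meas [measurable]: "(\<lambda>x. x) \<in> borel_measurable \<nu>"
    unfolding measurable_cong_sets[OF sets refl] by (intro measurable_restrict_space1) simp
  have "{0} \<in> sets \<nu>" unfolding sets by (subst sets_restrict_space_iff) auto
  then have "{0} \<in> null_sets \<nu>" using zero by (auto simp: P.emeasure_eq_measure)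
  then have "AE x in \<nu>. x \<notin> {0}" by (rule AE_not_in)
  then have pos: "AE x in \<nu>. 0 < x"
    by (rule AE_mp) (use space in \<open>auto intro!: AE_I2\<close>)
  have all_pos: "AE \<omega> in fpp_measure E \<nu>. \<forall>e\<in>E. 0 < \<omega> e"
    using countable_E assms(1) pos by (subst AE_ball_countable) (auto intro: AE_PiM_component)
  define K where "K = real ((D + 1) * D)"
  define q where "q = 1 / (2 * (K + 1))"
  have "0 \<le> K" by (simp add: K_def)
  then have "0 < q" "K * q \<le> 1 / 2" by (simp_all add: q_def field_simps)
  then have q: "0 < q" "real ((D + 1) * D) * q \<le> 1 / 2" unfolding K_def by simp_all
  have "(\<lambda>k. \<integral>x. exp (- real k * x + 1) \<partial>\<nu>) \<longlonglongrightarrow> (\<integral>x. 0 \<partial>\<nu>)"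
  proof (rule integral_dominated_convergence[where w = "\<lambda>_. exp 1"])
    show "AE x in \<nu>. (\<lambda>k. exp (- real k * x + 1)) \<longlonglongrightarrow> 0"
      using pos
    proof (rule AE_mp, intro AE_I2 impI)
      fix x :: real assume "0 < x"
      then have "(\<lambda>k. exp 1 * exp (- x) ^ k) \<longlonglongrightarrow> exp 1 * 0"
        by (intro tendsto_mult tendsto_const LIMSEQ_power_zero) simp
      moreover have "exp 1 * exp (- x) ^ k = exp (- real k * x + 1)" for k
        by (simp add: exp_of_nat_mult[symmetric] flip: exp_add)
      ultimately show "(\<lambda>k. exp (- real k * x + 1)) \<longlonglongrightarrow> 0" by simp
    qed
    show "AE x in \<nu>. norm (exp (- real k * x + 1)) \<le> exp 1" for k
      using space by (intro AE_I2) auto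
  qed auto
  then have "eventually (\<lambda>k. (\<integral>x. exp (- real k * x + 1) \<partial>\<nu>) < q) sequentially"
    using q(1) by (intro order_tendstoD(2)) auto
  then obtain k where k: "(\<integral>x. exp (- real k * x + 1) \<partial>\<nu>) < q"
    by (auto simp: eventually_sequentially)
  have "integrable \<nu> (\<lambda>x. exp (- real k * x + 1))"
    using space by (intro P.integrable_const_bound[of _ "exp 1"] AE_I2) auto
  then have "(\<integral>\<^sup>+x. ennreal (exp (- real k * x + 1)) \<partial>\<nu>) \<le> ennreal q"
    using k by (subst nn_integral_eq_integral) (auto intro: ennreal_leI)
  then have lower: "AE \<omega> in fpp_measure E \<nu>. \<exists>S\<ge>0. \<forall>n. \<forall>p\<in>long_paths n.
      - real k * weighted_length \<omega> p + 1 * real n \<le> S"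
    using q assms(1) meas by (intro AE_long_paths_bound[where q = q]) auto
  have "integrable (distr (fpp_measure E \<nu>) \<nu> (\<lambda>\<omega>. \<omega> e)) (\<lambda>x. exp (c * x))"
    using c(2,3) by (subst integrable_distr_eq) auto
  then have int_exp: "integrable \<nu> (\<lambda>x. exp (c * x))"
    using assms(1) c(2) by (subst (asm) distr_PiM_component) auto
  define B where "B = (\<integral>x. exp (c * x) \<partial>\<nu>)"
  have B: "0 \<le> B" unfolding B_def by (intro integral_nonneg_AE) auto
  define l where "l = ln ((B + 1) / q)"
  have l: "exp l = (B + 1) / q" unfolding l_def using B q(1) by simp
  have "(\<integral>\<^sup>+x. ennreal (exp (c * x + - l)) \<partial>\<nu>) = (\<integral>\<^sup>+x. ennreal (exp (- l)) * ennreal (exp (c * x)) \<partial>\<nu>)"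
    by (intro nn_integral_cong) (simp add: exp_add[symmetric] ennreal_mult[symmetric])
  also have "\<dots> = ennreal (exp (- l) * B)"
    using int_exp B unfolding B_def
    by (subst nn_integral_cmult) (auto simp: nn_integral_eq_integral ennreal_mult)
  also have "\<dots> \<le> ennreal q"
    using B q(1) by (intro ennreal_leI) (simp add: exp_minus l field_simps)
  finally have upper: "AE \<omega> in fpp_measure E \<nu>. \<exists>S\<ge>0. \<forall>n. \<forall>p\<in>long_paths n.
      c * weighted_length \<omega> p + - l * real n \<le> S"
    using q assms(1) meas by (intro AE_long_paths_bound[where q = q]) auto
  show ?thesis
    using all_pos lower upper
  proof eventually_elim
    case (elim \<omega>)
    then obtain S T where S: "0 \<le> S" "\<And>n p. p \<in> long_paths n \<Longrightarrow> - real k * weighted_length \<omega> p + 1 * real n \<le> S"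
      and T: "0 \<le> T" "\<And>n p. p \<in> long_paths n \<Longrightarrow> c * weighted_length \<omega> p + - l * real n \<le> T"
      by blast
    have "weighted_length \<omega> p \<le> (\<bar>l\<bar> / c) * real n + (S + T / c)" if "p \<in> long_paths n" for n p
    proof -
      have "c * weighted_length \<omega> p \<le> l * real n + T" using T(2)[OF that] by simp
      also have "l * real n \<le> \<bar>l\<bar> * real n" by (intro mult_right_mono) auto
      finally have "weighted_length \<omega> p \<le> (\<bar>l\<bar> * real n + T) / c"
        using c(1) by (simp add: field_simps)
      then show ?thesis using S(1) by (simp add: add_divide_distrib)
    qed
    moreover have "real n \<le> real k * weighted_length \<omega> p + (S + T / c)" if "p \<in> long_paths n" for n p
    proof -
      have "0 \<le> T / c" using T(1) c(1) by simp
      then show ?thesis using S(2)[OF that] by simp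
    qed
    moreover have "0 \<le> \<bar>l\<bar> / c" "0 \<le> S + T / c" using S(1) T(1) c(1) by simp_all
    ultimately show ?case
      unfolding regular_def using elim
      by (intro conjI exI[of _ "\<bar>l\<bar> / c"] exI[of _ "real k"] exI[of _ "S + T / c"]) auto
  qed
qed

end

section \<open>Bi-infinite geodesics in first passage percolation\<close>

theorem corollary1p5:
  fixes V :: "'v set" and E :: "'v set set" and \<nu> :: "real measure"
  assumes "simple_graph V E"
    and "connected_graph V E"
    and "hyperbolic_graph V E"
    and "bounded_degree V E"
    and "\<exists>\<gamma>. biinf_geodesic V E \<gamma>"
    and "prob_space \<nu>"
    and "sets \<nu> = sets (restrict_space borel {0..})"
    and "measure \<nu> {0} = 0"
    and "\<exists>c>0. \<forall>e\<in>E. integrable (fpp_measure E \<nu>) (\<lambda>\<omega>. exp (c * \<omega> e))"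
  shows "(AE \<omega> in fpp_measure E \<nu>. \<exists>\<gamma>. weighted_biinf_geodesic V E \<omega> \<gamma>) \<and>
    (\<forall>\<gamma> x y. biinf_quasi_geodesic V E \<gamma> \<and> to_opposite_ends \<gamma> x y \<longrightarrow>
       (AE \<omega> in fpp_measure E \<nu>. \<exists>A. finite A \<and> A \<subseteq> V \<and>
          (\<forall>n. (\<exists>p. weighted_geodesic_between V E \<omega> (x n) (y n) p) \<and>
               (\<forall>p. weighted_geodesic_between V E \<omega> (x n) (y n) p \<longrightarrow> set p \<inter> A \<noteq> {}))))"
proof -
  \<comment> \<open>The vertex \<open>\<gamma>0 0\<close> is the base for all quasi-geodesics \<open>\<gamma>\<close>.\<close>
  obtain \<gamma>0 where \<gamma>0: "biinf_geodesic V E \<gamma>0" using assms(5) by blast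
  have G: "conn_graph V E" using assms(1,2) by unfold_locales
  have e: "{\<gamma>0 0, \<gamma>0 1} \<in> E"
    using \<gamma>0 unfolding biinf_geodesic_def biinf_path_def by (metis add_0)
  obtain D where D: "\<And>v. v \<in> V \<Longrightarrow> finite {e \<in> E. v \<in> e} \<and> card {e \<in> E. v \<in> e} \<le> D"
    using assms(4) unfolding bounded_degree_def by blast
  obtain \<delta> :: real where \<delta>: "\<And>x \<gamma>. geodesic_triangle V E x \<gamma> \<Longrightarrow> thin_triangle V E \<delta> \<gamma>"
    using assms(3) unfolding hyperbolic_graph_def by blast
  have "thin_triangle V E (real (nat \<lceil>\<delta>\<rceil>)) \<gamma>" if "geodesic_triangle V E x \<gamma>" for x \<gamma>
  proof -
    have "\<delta> \<le> real (nat \<lceil>\<delta>\<rceil>)" by linarith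
    then show ?thesis 
      using \<delta>[OF that] unfolding thin_triangle_def by (fast intro: order_trans)
  qed
  then interpret fpp_graph V E "nat \<lceil>\<delta>\<rceil>" D "\<gamma>0 0"
    using assms(1,2) D conn_graph.edge_ends(1)[OF G e] by unfold_locales
  obtain c where "0 < c" "integrable (fpp_measure E \<nu>) (\<lambda>\<omega>. exp (c * \<omega> {\<gamma>0 0, \<gamma>0 1}))"
    using assms(9) e by blast
  then have regular: "AE \<omega> in fpp_measure E \<nu>. regular \<omega>"
    using AE_regular[OF assms(6-8) _ e] by blast
  show ?thesis
  proof (intro conjI allI impI)
    show "AE \<omega> in fpp_measure E \<nu>. \<exists>\<gamma>. weighted_biinf_geodesic V E \<omega> \<gamma>"
      using regular by eventually_elim (rule weighted_biinf_geodesic_exists[OF _ \<gamma>0])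
  next
    fix \<gamma> :: "int \<Rightarrow> 'v" and x y :: "nat \<Rightarrow> 'v"
    assume "biinf_quasi_geodesic V E \<gamma> \<and> to_opposite_ends \<gamma> x y"
    then obtain s t :: "nat \<Rightarrow> int" where \<gamma>: "biinf_quasi_geodesic V E \<gamma>"
      and xy: "\<And>n. x n = \<gamma> (s n) \<and> y n = \<gamma> (t n)"
      and st: "filterlim s at_bot sequentially \<and> filterlim t at_top sequentially \<or>
        filterlim s at_top sequentially \<and> filterlim t at_bot sequentially"
      unfolding to_opposite_ends_def by blast
    show "AE \<omega> in fpp_measure E \<nu>. \<exists>A. finite A \<and> A \<subseteq> V \<and>
        (\<forall>n. (\<exists>p. weighted_geodesic_between V E \<omega> (x n) (y n) p) \<and>
          (\<forall>p. weighted_geodesic_between V E \<omega> (x n) (y n) p \<longrightarrow> set p \<inter> A \<noteq> {}))"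
      using regular
    proof eventually_elim
      case (elim \<omega>)
      from st show ?case
      proof
        assume "filterlim s at_bot sequentially \<and> filterlim t at_top sequentially"
        then show ?thesis by (intro weighted_geodesics_meet_finite_set[OF elim \<gamma> xy]) simp_all
      next
        assume "filterlim s at_top sequentially \<and> filterlim t at_bot sequentially"
        then have "filterlim (\<lambda>n. - s n) at_bot sequentially" "filterlim (\<lambda>n. - t n) at_top sequentially"
          by (simp_all add: filterlim_at_bot filterlim_at_top minus_le_iff[of "s _"] le_minus_iff[of _ "t _"])
        then show ?thesis
          by (intro weighted_geodesics_meet_finite_set[OF elim quasi_geodesic_reverse[OF \<gamma>],
              of x "\<lambda>n. - s n" y "\<lambda>n. - t n"]) (simp_all add: xy)
      qed
    qed
  qed
qed

end
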